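(* Let $A$ be a finite non-local commutative ring. Then the line graph $L(EG(A))$ of the essential graph of $A$ is planar if and only if $A$ is isomorphic to one of the rings: $\mathbb{Z}_2\times\mathbb{Z}_2$, $\mathbb{Z}_2\times\mathbb{Z}_3$, $\mathbb{Z}_3\times\mathbb{Z}_3$, $\mathbb{Z}_2\times\mathbb{F}_4$, $\mathbb{Z}_3\times\mathbb{F}_4$, $\mathbb{Z}_2\times\mathbb{Z}_5$, $\mathbb{Z}_2\times\mathbb{Z}_2\times\mathbb{Z}_2$.
   Context: All rings have unity $1\neq 0$. $\mathbb{Z}_n$ is the ring of integers modulo $n$ and $\mathbb{F}_n$ the finite field with $n$ elements. A ring is local if it has exactly one maximal ideal. An ideal $I$ of a commutative ring $A$ is essential if $I\cap J\neq 0$ for every non-zero ideal $J$ of $A$ (so $A$ itself is essential). For $s\in A$, $\mathrm{ann}_A(s)=\{r\in A : sr=0\}$. The essential graph $EG(A)$ is the simple undirected graph whose vertices are the non-zero zero-divisors of $A$, two distinct vertices $u,v$ being adjacent if and only if $\mathrm{ann}_A(uv)$ is an essential ideal of $A$. The line graph $L(G)$ of a graph $G$ has the edges of $G$ as vertices, two distinct ones being adjacent exactly when the corresponding edges share an endpoint in $G$. A graph is planar if it can be drawn in the plane without edge crossings. *)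

theory Defs
  imports "HOL-Analysis.Analysis" "HOL-Algebra.Algebra" "HOL-Number_Theory.Residues"
begin

section \<open>Rings\<close>

definition local_ring :: "('a, 'm) ring_scheme \<Rightarrow> bool" where
  "local_ring A \<longleftrightarrow> (\<exists>!M. maximalideal M A)"

definition nonzero_zero_divisors :: "('a, 'm) ring_scheme \<Rightarrow> 'a set" where
  "nonzero_zero_divisors A =
     {a \<in> carrier A - {\<zero>\<^bsub>A\<^esub>}. \<exists>b \<in> carrier A - {\<zero>\<^bsub>A\<^esub>}. a \<otimes>\<^bsub>A\<^esub> b = \<zero>\<^bsub>A\<^esub>}"

definition ann :: "('a, 'm) ring_scheme \<Rightarrow> 'a \<Rightarrow> 'a set" where
  "ann A s = {r \<in> carrier A. s \<otimes>\<^bsub>A\<^esub> r = \<zero>\<^bsub>A\<^esub>}"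

definition essential_ideal :: "'a set \<Rightarrow> ('a, 'm) ring_scheme \<Rightarrow> bool" where
  "essential_ideal I A \<longleftrightarrow>
     ideal I A \<and> (\<forall>J. ideal J A \<and> J \<noteq> {\<zero>\<^bsub>A\<^esub>} \<longrightarrow> I \<inter> J \<noteq> {\<zero>\<^bsub>A\<^esub>})"

text \<open>
  The pair \<open>(a, b)\<close> stands for \<open>a + b * w\<close> in the extension of the integers modulo 2 by an
  element \<open>w\<close> with \<open>w * w = w + 1\<close>, that is, in the quotient of the polynomial ring over the
  field with two elements by \<open>X^2 + X + 1\<close>.
\<close>

definition F4 :: "(int \<times> int) ring" where
  "F4 = \<lparr>carrier = {0..1} \<times> {0..1},
         monoid.mult = (\<lambda>(a, b) (c, d). ((a * c + b * d) mod 2, (a * d + b * c + b * d) mod 2)),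
         monoid.one = (1, 0),
         ring.zero = (0, 0),
         ring.add = (\<lambda>(a, b) (c, d). ((a + c) mod 2, (b + d) mod 2))\<rparr>"

lemma carrier_F4: "carrier F4 = {(0, 0), (0, 1), (1, 0), (1, 1)}"
proof -
  have "{0..1::int} = {0, 1}" by auto
  then show ?thesis by (auto simp: F4_def)
qed

lemma order_F4: "order F4 = 4"
  by (simp add: order_def carrier_F4)

lemma field_F4: "field F4"
proof -
  have "cring F4"
  proof (rule cringI)
    show "abelian_group F4"
      by (rule abelian_groupI; unfold carrier_F4) (auto simp: F4_def)
    show "Group.comm_monoid F4"
      by (rule Group.comm_monoidI; unfold carrier_F4) (auto simp: F4_def)
    show "(x \<oplus>\<^bsub>F4\<^esub> y) \<otimes>\<^bsub>F4\<^esub> z = x \<otimes>\<^bsub>F4\<^esub> z \<oplus>\<^bsub>F4\<^esub> y \<otimes>\<^bsub>F4\<^esub> z"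
      if "x \<in> carrier F4" "y \<in> carrier F4" "z \<in> carrier F4" for x y z
      using that unfolding carrier_F4 by (auto simp: F4_def)
  qed
  then interpret cring F4 .
  show ?thesis
  proof (rule cring_fieldI2)
    show "\<zero>\<^bsub>F4\<^esub> \<noteq> \<one>\<^bsub>F4\<^esub>" by (simp add: F4_def)
    show "\<exists>b\<in>carrier F4. a \<otimes>\<^bsub>F4\<^esub> b = \<one>\<^bsub>F4\<^esub>" if "a \<in> carrier F4" "a \<noteq> \<zero>\<^bsub>F4\<^esub>" for a
      using that unfolding carrier_F4 by (auto simp: F4_def)
  qed
qed

section \<open>Graphs\<close>

text \<open>
  A simple undirected graph is a set of vertices together with a set of edges, each edge being
  the two-element set of its endpoints.
\<close>

type_synonym 'v graph = "'v set \<times> 'v set set"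

abbreviation verts :: "'v graph \<Rightarrow> 'v set" where "verts \<equiv> fst"
abbreviation edges :: "'v graph \<Rightarrow> 'v set set" where "edges \<equiv> snd"

definition essential_graph :: "('a, 'm) ring_scheme \<Rightarrow> 'a graph" where
  "essential_graph A =
     (nonzero_zero_divisors A,
      {{u, v} | u v. u \<in> nonzero_zero_divisors A \<and> v \<in> nonzero_zero_divisors A \<and> u \<noteq> v \<and>
                     essential_ideal (ann A (u \<otimes>\<^bsub>A\<^esub> v)) A})"

definition line_graph :: "'v graph \<Rightarrow> 'v set graph" where
  "line_graph G =
     (edges G, {{e, f} | e f. e \<in> edges G \<and> f \<in> edges G \<and> e \<noteq> f \<and> e \<inter> f \<noteq> {}})"

text \<open>
  A drawing in the plane sends vertices to distinct points and every edge to a simple arc joining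
  the images of its endpoints. There are no crossings if an arc passes through no vertex other
  than its two ends, and two arcs meet only in images of common endpoints.
\<close>

definition plane_drawing :: "'v graph \<Rightarrow> ('v \<Rightarrow> complex) \<Rightarrow> ('v set \<Rightarrow> real \<Rightarrow> complex) \<Rightarrow> bool" where
  "plane_drawing G p \<gamma> \<longleftrightarrow>
     inj_on p (verts G) \<and>
     (\<forall>e \<in> edges G. arc (\<gamma> e) \<and> {pathstart (\<gamma> e), pathfinish (\<gamma> e)} = p ` e \<and>
                     path_image (\<gamma> e) \<inter> p ` verts G = p ` e) \<and>
     (\<forall>e \<in> edges G. \<forall>f \<in> edges G. e \<noteq> f \<longrightarrow>
        path_image (\<gamma> e) \<inter> path_image (\<gamma> f) = p ` (e \<inter> f))"

definition planar :: "'v graph \<Rightarrow> bool" where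
  "planar G \<longleftrightarrow> (\<exists>p \<gamma>. plane_drawing G p \<gamma>)"

end

theory Submission
  imports Defs
begin

text \<open>
  A finite commutative ring with more than one maximal ideal has an idempotent \<open>e\<close>
  other than 0 and 1 (\<open>nonlocal_obtain_idempotent\<close>), so it is the product of the
  corner rings of \<open>e\<close> and \<open>1 - e\<close>.

  The annihilator of an element of square zero is essential, and in a reduced ring only 0 has an
  essential annihilator. If the ring has a non-zero element \<open>n\<close> of square zero, it
  may be taken in one corner. Then \<open>n\<close> is the hub of a fan in the essential graph,
  and the line graph is not planar. If the ring is reduced, every pair of complementary
  idempotents gives a complete bipartite subgraph of the essential graph, of sizes
  \<open>m - 1\<close> and \<open>n - 1\<close> where \<open>m\<close> and \<open>n\<close> are
  the orders of the corners. Since the complete bipartite graphs with parts of sizes 1 and 5, 2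
  and 4, and 3 and 3 have non-planar line graphs, only \<open>m = 2\<close> with
  \<open>n \<le> 5\<close> and \<open>m = 3\<close> with \<open>n \<le> 4\<close> survive for
  \<open>m \<le> n\<close>. Rings of order 2, 3 and 5 are residue rings, and a reduced ring of
  order 4 is the field or splits once more. In the second case the other idempotents leave only
  the product of three rings of order 2 (\<open>planar_imp_listed\<close>).

  Non-planarity is a statement about arcs in the plane and rests on the Jordan curve theorem,
  through the splitting of the inside of a Jordan curve by an arc. Applied to a theta curve on
  either of its sides, it yields two obstructions: a connected set cannot touch all three arcs
  of a theta curve (\<open>theta_no_triple_touch\<close>), and it cannot touch all four vertices
  of a drawing of the complete graph on four vertices
  (\<open>no_touch_all_of_tetrahedron\<close>). The second excludes the fan and the bipartite
  graphs with 1 + 5 and 2 + 4 vertices, where four edges at one vertex all touch a connected set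
  of further edges; the first excludes 3 + 3.

  For the converse, the line graphs that occur for the listed rings are graphs on at most four
  vertices, a prism, and a triangle with a further triangle on each side. All of these are
  subgraphs of one planar graph on seven vertices, for which integer coordinates of a
  straight-line drawing are checked by computation (\<open>planar_host\<close>).
\<close>

section \<open>Theta curves in the plane\<close>

definition theta_curve :: "complex \<Rightarrow> complex \<Rightarrow> (real \<Rightarrow> complex) \<Rightarrow> (real \<Rightarrow> complex) \<Rightarrow> (real \<Rightarrow> complex) \<Rightarrow> bool" where
  "theta_curve a b c1 c2 c \<longleftrightarrow> a \<noteq> b \<and>
     (\<forall>g \<in> {c1, c2, c}. arc g \<and> pathstart g = a \<and> pathfinish g = b) \<and>
     path_image c1 \<inter> path_image c2 = {a, b} \<and>
     path_image c1 \<inter> path_image c = {a, b} \<and>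
     path_image c2 \<inter> path_image c = {a, b}"

lemma theta_curve_swap:
  "theta_curve a b c1 c2 c \<Longrightarrow> theta_curve a b c2 c1 c"
  "theta_curve a b c1 c2 c \<Longrightarrow> theta_curve a b c c1 c2"
  by (auto simp: theta_curve_def)

lemma theta_curve_Jordan:
  assumes "theta_curve a b c1 c2 c"
  defines "S \<equiv> path_image c1 \<union> path_image c2"
  shows "inside S \<noteq> {}" "open (inside S)" "connected (inside S)" "bounded (inside S)"
    "open (outside S)" "connected (outside S)" "\<not> bounded (outside S)" "closed S"
proof -
  have sp: "simple_path (c1 +++ reversepath c2)"
    using assms by (auto simp: theta_curve_def simple_path_join_loop_eq arc_reversepath)
  have S: "S = path_image (c1 +++ reversepath c2)"
    using assms by (auto simp: theta_curve_def path_image_join)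
  have loop: "pathfinish (c1 +++ reversepath c2) = pathstart (c1 +++ reversepath c2)"
    using assms by (auto simp: theta_curve_def)
  show "inside S \<noteq> {}" "open (inside S)" "connected (inside S)" "bounded (inside S)"
    "open (outside S)" "connected (outside S)" "\<not> bounded (outside S)"
    using Jordan_inside_outside [OF sp loop] unfolding S by auto
  show "closed S"
    unfolding S using sp by (simp add: closed_simple_path_image)
qed

lemma connected_one_side:
  assumes "connected T" "T \<inter> S = {}" "closed (S :: complex set)"
  shows "T \<subseteq> inside S \<or> T \<subseteq> outside S"
proof -
  have "T \<subseteq> inside S \<union> outside S"
    using assms(2) by auto
  moreover have "inside S \<inter> outside S \<inter> T = {}"
    by auto
  ultimately have "inside S \<inter> T = {} \<or> outside S \<inter> T = {}"
    using connectedD [OF assms(1) open_inside [OF assms(3)] open_outside [OF assms(3)]]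
    by blast
  then show ?thesis
    using \<open>T \<subseteq> inside S \<union> outside S\<close> by blast
qed

lemma open_arc_connected:
  assumes "arc c" "pathstart c = a" "pathfinish c = b"
  shows "connected (path_image c - {a, b})"
  using connected_simple_path_endless [OF arc_imp_simple_path [OF assms(1)]] assms by simp

text \<open>
  An arc is connected with more than one point, so none of its points is isolated; deleting
  finitely many other points does not change that.
\<close>

lemma endpoints_in_closure_open_arc:
  fixes c :: "real \<Rightarrow> complex"
  assumes "arc c" "pathstart c = a" "pathfinish c = b"
  shows "{a, b} \<subseteq> closure (path_image c - {a, b})"
proof -
  have ab: "a \<noteq> b" "{a, b} \<subseteq> path_image c"
    using arc_distinct_ends [OF assms(1)] assms by auto
  have "x islimpt path_image c" if "x \<in> {a, b}" for x
  proof (rule connected_imp_perfect [OF connected_arc_image [OF assms(1)]])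
    show "x \<in> path_image c" "path_image c \<noteq> {y}" for y
      using that ab by auto
  qed
  moreover have "(path_image c - {a, b}) \<union> {a, b} = path_image c"
    using ab by blast
  ultimately have "x islimpt (path_image c - {a, b}) \<union> {a, b}" if "x \<in> {a, b}" for x
    using that by simp
  then show ?thesis
    by (simp add: islimpt_insert closure_def)
qed

text \<open>
  The third arc splits the inside of the Jordan curve into two regions, and a connected set that
  avoids it stays in one of them. The closure of that region contains no inner point of the
  outer arc that does not bound it.
\<close>

lemma theta_inside_touch:
  assumes \<theta>: "theta_curve a b c1 c2 c"
    and T: "connected T" "T \<inter> path_image c = {}"
    and side: "T \<subseteq> inside (path_image c1 \<union> path_image c2)"
      "path_image c \<inter> inside (path_image c1 \<union> path_image c2) \<noteq> {}"
  shows "closure T \<inter> (path_image c1 - {a, b}) = {} \<or> closure T \<inter> (path_image c2 - {a, b}) = {}"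
proof -
  let ?S = "path_image c1 \<union> path_image c2"
  let ?S1 = "path_image c1 \<union> path_image c" and ?S2 = "path_image c2 \<union> path_image c"
  have sub: "inside ?S1 \<inter> inside ?S2 = {}"
    "inside ?S1 \<union> inside ?S2 \<union> (path_image c - {a,b}) = inside ?S"
    using split_inside_simple_closed_curve [of c1 a b c2 c] \<theta> side(2)
    by (auto simp: theta_curve_def arc_imp_simple_path)
  have closed: "closed ?S1" "closed ?S2"
    using theta_curve_Jordan(8) [OF theta_curve_swap(2) [OF \<theta>]]
      theta_curve_Jordan(8) [OF theta_curve_swap(2) [OF theta_curve_swap(1) [OF \<theta>]]]
    by (simp_all add: Un_commute)
  have "T \<subseteq> inside ?S1 \<union> inside ?S2"
    using side(1) T(2) sub(2) by blast
  then have "T \<subseteq> inside ?S1 \<or> T \<subseteq> inside ?S2"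
    using connectedD [OF T(1) open_inside [OF closed(1)] open_inside [OF closed(2)]] sub(1)
    by blast
  have away: "closure T \<inter> (path_image ci' - {a, b}) = {}"
    if "T \<subseteq> inside (path_image ci \<union> path_image c)" "closed (path_image ci \<union> path_image c)"
      "inside (path_image ci \<union> path_image c) \<subseteq> inside ?S"
      "path_image ci' \<subseteq> ?S" "path_image ci' \<inter> path_image ci = {a, b}"
      "path_image ci' \<inter> path_image c = {a, b}" for ci ci'
  proof -
    have "closure T \<subseteq> (path_image ci \<union> path_image c) \<union> inside ?S"
      using closure_mono [OF that(1)] closure_inside_subset [OF that(2)] that(3) by blast
    moreover have "inside ?S \<inter> path_image ci' = {}"
      using that(4) inside_no_overlap by blast
    ultimately show ?thesis
      using that(5,6) by blast
  qed
  have "path_image c1 \<inter> path_image c2 = {a, b}" "path_image c2 \<inter> path_image c1 = {a, b}"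
    "path_image c1 \<inter> path_image c = {a, b}" "path_image c2 \<inter> path_image c = {a, b}"
    using \<theta> by (auto simp: theta_curve_def)
  moreover have "inside ?S1 \<subseteq> inside ?S" "inside ?S2 \<subseteq> inside ?S"
    using sub(2) by blast+
  ultimately show ?thesis
    using \<open>T \<subseteq> inside ?S1 \<or> T \<subseteq> inside ?S2\<close> away [of c1 c2] away [of c2 c1] closed
    by blast
qed

text \<open>
  Inversion at a point of the inside adds the point at infinity to the outside: the image of the
  outside accumulates at 0, and together with 0 it is connected and misses the image curve. The
  image of the punctured inside is connected and unbounded, so it lies outside the image curve;
  what is left for the non-empty inside of the image curve is the image of the outside.
\<close>

lemma inversion_outside_to_inside:
  assumes \<theta>: "theta_curve a b c1 c2 c"
    and z0: "z0 \<in> inside (path_image c1 \<union> path_image c2)"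
    and \<theta>': "theta_curve (f a) (f b) (f \<circ> c1) (f \<circ> c2) (f \<circ> c)"
    and f: "f = (\<lambda>w. inverse (w - z0))"
  shows "f ` outside (path_image c1 \<union> path_image c2)
      \<subseteq> inside (path_image (f \<circ> c1) \<union> path_image (f \<circ> c2))"
proof -
  let ?S = "path_image c1 \<union> path_image c2"
  let ?S' = "path_image (f \<circ> c1) \<union> path_image (f \<circ> c2)"
  note J = theta_curve_Jordan [OF \<theta>] and J' = theta_curve_Jordan [OF \<theta>']
  have S': "?S' = f ` ?S"
    by (auto simp: path_image_def)
  have inj: "inj f"
    by (auto simp: f inj_def)
  have z0S: "z0 \<notin> ?S" "z0 \<notin> outside ?S"
    using z0 inside_no_overlap inside_Int_outside by blast+
  have cont: "continuous_on A f" if "z0 \<notin> A" for A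
    unfolding f using that by (intro continuous_intros) auto
  let ?O = "insert 0 (f ` outside ?S)"
  have O: "connected ?O"
  proof (rule connected_intermediate_closure)
    show "connected (f ` outside ?S)"
      using connected_continuous_image [OF cont [OF z0S(2)] J(6)] .
    have "0 \<in> closure (f ` outside ?S)"
      unfolding closure_approachable
    proof (intro allI impI)
      fix e :: real assume e: "e > 0"
      obtain w where w: "w \<in> outside ?S" "norm w > norm z0 + 1/e"
        using J(7) unfolding bounded_iff by (meson not_le)
      have "norm (w - z0) > 1/e"
        using w(2) norm_triangle_ineq2 [of w z0] by linarith
      then have "norm (f w) < e"
        using e unfolding f norm_inverse
        by (metis inverse_eq_divide inverse_inverse_eq less_imp_inverse_less zero_less_divide_1_iff)
      then show "\<exists>y\<in>f ` outside ?S. dist y 0 < e"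
        using w(1) by auto
    qed
    then show "insert 0 (f ` outside ?S) \<subseteq> closure (f ` outside ?S)"
      using closure_subset [of "f ` outside ?S"] by blast
  qed auto
  have O_off: "?O \<inter> ?S' = {}"
  proof -
    have "0 \<notin> f ` ?S"
      using z0S(1) by (auto simp: f)
    moreover have "f ` outside ?S \<inter> f ` ?S = {}"
      using outside_no_overlap [of ?S] by (simp add: Int_commute flip: image_Int [OF inj])
    ultimately show ?thesis
      unfolding S' by auto
  qed
  let ?I = "f ` (inside ?S - {z0})"
  have I: "connected ?I"
    using connected_continuous_image [OF cont connected_open_delete [OF J(2,3)]] by simp
  have I_off: "?I \<inter> ?S' = {}"
    using inside_no_overlap [of ?S] image_Int [OF inj, of "inside ?S - {z0}" ?S]
    unfolding S' by blast
  have I_unbounded: "\<not> bounded ?I"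
  proof
    assume "bounded ?I"
    then obtain B where B: "B > 0" "\<And>w. w \<in> inside ?S - {z0} \<Longrightarrow> norm (f w) \<le> B"
      unfolding bounded_pos by auto
    obtain r where r: "r > 0" "ball z0 r \<subseteq> inside ?S"
      using J(2) z0 open_contains_ball by blast
    \<comment> \<open>the point \<open>z0 + t\<close> is sent to distance \<open>1 / t\<close> from 0, which is beyond the bound \<open>B\<close>\<close>
    define t where "t = min (r/2) (1 / (2*B))"
    have t: "0 < t" "t < r" "t \<le> 1 / (2*B)"
      using r B by (auto simp: t_def)
    have "z0 + of_real t \<in> inside ?S - {z0}"
      using r(2) t by (auto simp: dist_norm)
    then have "norm (f (z0 + of_real t)) \<le> B"
      by (rule B(2))
    moreover have "norm (f (z0 + of_real t)) = 1 / t"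
      using t by (simp add: f norm_inverse inverse_eq_divide norm_divide)
    moreover have "1 / t \<ge> 2 * B"
      using t B(1) by (simp add: field_simps)
    ultimately show False
      using B(1) by linarith
  qed
  have "?I \<subseteq> outside ?S'"
    using connected_one_side [OF I I_off J'(8)] I_unbounded J'(4) bounded_subset by blast
  moreover have "inside ?S' \<subseteq> ?O \<union> ?I"
  proof
    fix y assume y: "y \<in> inside ?S'"
    show "y \<in> ?O \<union> ?I"
    proof (cases "y = 0")
      case False
      define w where "w = z0 + inverse y"
      have fw: "f w = y" "w \<noteq> z0"
        using False by (auto simp: w_def f)
      then have "w \<notin> ?S"
        using y inside_no_overlap [of ?S'] unfolding S' by blast
      then have "w \<in> inside ?S \<or> w \<in> outside ?S"
        using inside_Un_outside [of ?S] by blast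
      then show ?thesis
        using fw by blast
    qed simp
  qed
  moreover obtain y where "y \<in> inside ?S'"
    using J'(1) by blast
  ultimately have "y \<in> ?O \<inter> inside ?S'"
    using inside_Int_outside [of ?S'] by blast
  then show ?thesis
    using connected_one_side [OF O O_off J'(8)] inside_Int_outside [of ?S'] by blast
qed

lemma closure_image_touch:
  fixes f :: "complex \<Rightarrow> complex"
  assumes "continuous_on (insert y T) f" "y \<in> closure T"
  shows "f y \<in> closure (f ` T)"
proof -
  obtain x where x: "\<And>n. x n \<in> T" "x \<longlonglongrightarrow> y"
    using assms(2) unfolding closure_sequential by blast
  then have "(\<lambda>n. f (x n)) \<longlonglongrightarrow> f y"
    using continuous_on_tendsto_compose [OF assms(1) x(2)] by (simp add: always_eventually)
  then show ?thesis
    unfolding closure_sequential using x(1) by (intro exI [of _ "\<lambda>n. f (x n)"]) auto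
qed

text \<open>
  The inversion carries this situation to the one where everything lies inside the Jordan curve.
\<close>

lemma theta_outside_touch:
  assumes \<theta>: "theta_curve a b c1 c2 c"
    and T: "connected T" "T \<inter> path_image c = {}"
    and side: "T \<subseteq> outside (path_image c1 \<union> path_image c2)"
      "path_image c - {a, b} \<subseteq> outside (path_image c1 \<union> path_image c2)"
  shows "closure T \<inter> (path_image c1 - {a, b}) = {} \<or> closure T \<inter> (path_image c2 - {a, b}) = {}"
proof -
  let ?S = "path_image c1 \<union> path_image c2"
  obtain z0 where z0: "z0 \<in> inside ?S"
    using theta_curve_Jordan(1) [OF \<theta>] by blast
  define f where "f = (\<lambda>w. inverse (w - z0))"
  have z0S: "z0 \<notin> ?S" "z0 \<notin> outside ?S"
    using z0 inside_no_overlap inside_Int_outside by blast+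
  have z0c: "z0 \<notin> path_image c"
    using side(2) z0S \<theta> unfolding theta_curve_def by blast
  have cont: "continuous_on A f" if "z0 \<notin> A" for A
    unfolding f_def using that by (intro continuous_intros) auto
  have inj: "inj f"
    by (auto simp: f_def inj_def)
  have arcs: "arc (f \<circ> g)" if "arc g" "z0 \<notin> path_image g" for g
    using that inj continuous_on_compose [of "{0..1}" g f, OF _ cont]
    unfolding arc_def path_def path_image_def
    by (auto intro!: comp_inj_on intro: inj_on_subset)
  have im: "path_image (f \<circ> g) = f ` path_image g" for g
    by (auto simp: path_image_def)
  have \<theta>': "theta_curve (f a) (f b) (f \<circ> c1) (f \<circ> c2) (f \<circ> c)"
    using \<theta> z0S z0c
    by (simp add: theta_curve_def im arcs pathstart_compose pathfinish_compose inj_eq [OF inj]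
        flip: image_Int [OF inj])
  have O: "f ` outside ?S \<subseteq> inside (path_image (f \<circ> c1) \<union> path_image (f \<circ> c2))"
    using inversion_outside_to_inside [OF \<theta> z0 \<theta>' f_def] .
  have "z0 \<notin> T"
    using side(1) z0S by blast
  then have T': "connected (f ` T)"
    by (intro connected_continuous_image cont T(1))
  have "path_image c - {a, b} \<noteq> {}"
    using nonempty_simple_path_endless [OF arc_imp_simple_path, of c] \<theta>
    by (auto simp: theta_curve_def)
  then have "path_image (f \<circ> c) \<inter> inside (path_image (f \<circ> c1) \<union> path_image (f \<circ> c2)) \<noteq> {}"
    using O side(2) unfolding im by blast
  moreover have "f ` T \<inter> path_image (f \<circ> c) = {}"
    using T(2) unfolding im by (simp flip: image_Int [OF inj])
  moreover have "f ` T \<subseteq> inside (path_image (f \<circ> c1) \<union> path_image (f \<circ> c2))"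
    using O side(1) by blast
  ultimately have *: "closure (f ` T) \<inter> (path_image (f \<circ> c1) - {f a, f b}) = {} \<or>
      closure (f ` T) \<inter> (path_image (f \<circ> c2) - {f a, f b}) = {}"
    using theta_inside_touch [OF \<theta>' T'] by blast
  have touch: "f y \<in> closure (f ` T) \<inter> (path_image (f \<circ> g) - {f a, f b})"
    if "y \<in> closure T \<inter> (path_image g - {a, b})" "path_image g \<subseteq> ?S" for y g
  proof -
    have "f y \<in> closure (f ` T)"
      using that z0S \<open>z0 \<notin> T\<close> by (intro closure_image_touch cont) auto
    then show ?thesis
      using that unfolding im by (auto simp: inj_eq [OF inj])
  qed
  show ?thesis
    using * touch [of _ c1] touch [of _ c2] by blast
qed

text \<open>
  On the same side of the Jordan curve as the third arc, the connected set would be confined to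
  a region that is bounded by the third arc and only one of the other two.
\<close>

lemma theta_opposite_sides:
  assumes \<theta>: "theta_curve a b c1 c2 c"
    and T: "connected T" "T \<inter> (path_image c1 \<union> path_image c2 \<union> path_image c) = {}"
    and touch: "closure T \<inter> (path_image c1 - {a, b}) \<noteq> {}" "closure T \<inter> (path_image c2 - {a, b}) \<noteq> {}"
  defines "S \<equiv> path_image c1 \<union> path_image c2"
  shows "T \<subseteq> inside S \<and> path_image c - {a, b} \<subseteq> outside S \<or>
         T \<subseteq> outside S \<and> path_image c - {a, b} \<subseteq> inside S"
proof -
  have closed: "closed S"
    using theta_curve_Jordan(8) [OF \<theta>] unfolding S_def .
  have c: "connected (path_image c - {a, b})"
    using \<theta> by (intro open_arc_connected) (auto simp: theta_curve_def)
  have "(path_image c - {a, b}) \<inter> S = {}"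
    using \<theta> by (auto simp: theta_curve_def S_def)
  then have "path_image c - {a, b} \<subseteq> inside S \<or> path_image c - {a, b} \<subseteq> outside S"
    using connected_one_side [OF c _ closed] by blast
  moreover have "T \<subseteq> inside S \<or> T \<subseteq> outside S"
    using connected_one_side [OF T(1) _ closed] T(2) unfolding S_def by blast
  moreover have "\<not> (T \<subseteq> outside S \<and> path_image c - {a, b} \<subseteq> outside S)"
    using theta_outside_touch [OF \<theta> T(1)] T(2) touch unfolding S_def by blast
  moreover have "path_image c - {a, b} \<noteq> {}"
    using nonempty_simple_path_endless [OF arc_imp_simple_path, of c] \<theta>
    by (auto simp: theta_curve_def)
  then have "\<not> (T \<subseteq> inside S \<and> path_image c - {a, b} \<subseteq> inside S)"
    using theta_inside_touch [OF \<theta> T(1)] T(2) touch unfolding S_def by blast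
  ultimately show ?thesis by blast
qed

text \<open>
  This is the non-planarity of the complete bipartite graph on 3 + 3 vertices in a form that
  covers all its subdivisions: the two ends of the theta curve and the connected set form one
  side, and an inner point of each arc, where the set touches it, forms the other. Touching two
  arcs forces it to lie on the other side from the third, where it cannot reach that arc.
\<close>

theorem theta_no_triple_touch:
  assumes \<theta>: "theta_curve a b c1 c2 c"
    and T: "connected T" "T \<inter> (path_image c1 \<union> path_image c2 \<union> path_image c) = {}"
    and touch: "closure T \<inter> (path_image c1 - {a, b}) \<noteq> {}" "closure T \<inter> (path_image c2 - {a, b}) \<noteq> {}"
      "closure T \<inter> (path_image c - {a, b}) \<noteq> {}"
  shows False
proof -
  let ?S = "path_image c1 \<union> path_image c2"
  have closed: "closed ?S"
    using theta_curve_Jordan(8) [OF \<theta>] .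
  have "closure T \<subseteq> ?S \<union> inside ?S" if "T \<subseteq> inside ?S"
    using closure_mono [OF that] closure_inside_subset [OF closed] by blast
  moreover have "closure T \<subseteq> ?S \<union> outside ?S" if "T \<subseteq> outside ?S"
    using closure_mono [OF that] closure_outside_subset [OF closed] by blast
  moreover have "path_image c \<inter> ?S = {a, b}"
    using \<theta> by (auto simp: theta_curve_def)
  ultimately show False
    using theta_opposite_sides [OF \<theta> T touch(1,2)] touch(3) inside_Int_outside [of ?S] by blast
qed

text \<open>
  This is the non-planarity of the complete graph on 5 vertices, with the fifth vertex replaced
  by a connected set. On the cycle through a, c, b, d the set has to lie across from the chord
  between a and b, and also across from the chord between c and d. But the open chord between c
  and d is itself a connected set that reaches c and d, so it lies across from the chord between
  a and b as well. Three sets cannot be pairwise separated by a curve with only two sides.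
\<close>

theorem no_touch_all_of_tetrahedron:
  assumes \<theta>: "theta_curve a b c1 c2 P" and \<theta>': "theta_curve c d d1 d2 Q"
    and cycle: "path_image c1 \<union> path_image c2 = path_image d1 \<union> path_image d2"
    and on: "c \<in> path_image c1 - {a, b}" "d \<in> path_image c2 - {a, b}"
      "a \<in> path_image d1 - {c, d}" "b \<in> path_image d2 - {c, d}"
    and PQ: "path_image P \<inter> path_image Q = {}"
    and T: "connected T" "T \<inter> (path_image c1 \<union> path_image c2 \<union> path_image P \<union> path_image Q) = {}"
    and touch: "{a, b, c, d} \<subseteq> closure T"
  shows False
proof -
  let ?S = "path_image c1 \<union> path_image c2"
  have TP: "T \<subseteq> inside ?S \<and> path_image P - {a, b} \<subseteq> outside ?S \<or>
        T \<subseteq> outside ?S \<and> path_image P - {a, b} \<subseteq> inside ?S"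
    using theta_opposite_sides [OF \<theta> T(1)] T(2) on touch by blast
  have TQ: "T \<subseteq> inside ?S \<and> path_image Q - {c, d} \<subseteq> outside ?S \<or>
        T \<subseteq> outside ?S \<and> path_image Q - {c, d} \<subseteq> inside ?S"
    using theta_opposite_sides [OF \<theta>' T(1)] T(2) on touch unfolding cycle by blast
  let ?Q = "path_image Q - {c, d}"
  have arcQ: "arc Q" "pathstart Q = c" "pathfinish Q = d"
    using \<theta>' by (auto simp: theta_curve_def)
  have ends: "c \<in> closure ?Q" "d \<in> closure ?Q"
    using endpoints_in_closure_open_arc [OF arcQ] by auto
  have Q_ne: "?Q \<noteq> {}"
    using nonempty_simple_path_endless [OF arc_imp_simple_path, of Q] arcQ by auto
  have P_ne: "path_image P - {a, b} \<noteq> {}"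
    using nonempty_simple_path_endless [OF arc_imp_simple_path, of P] \<theta>
    by (auto simp: theta_curve_def)
  have "?Q \<inter> (?S \<union> path_image P) = {}"
    using PQ \<theta>' unfolding cycle theta_curve_def by blast
  moreover have "closure ?Q \<inter> (path_image c1 - {a, b}) \<noteq> {}"
    "closure ?Q \<inter> (path_image c2 - {a, b}) \<noteq> {}"
    using on ends by auto
  ultimately have "?Q \<subseteq> inside ?S \<and> path_image P - {a, b} \<subseteq> outside ?S \<or>
         ?Q \<subseteq> outside ?S \<and> path_image P - {a, b} \<subseteq> inside ?S"
    using theta_opposite_sides [OF \<theta> open_arc_connected [OF arcQ]] by blast
  moreover obtain t p q where "t \<in> T" "p \<in> path_image P - {a, b}" "q \<in> ?Q"
    using Q_ne P_ne touch by fastforce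
  ultimately have "t \<in> inside ?S \<and> p \<in> outside ?S \<or> t \<in> outside ?S \<and> p \<in> inside ?S"
    "t \<in> inside ?S \<and> q \<in> outside ?S \<or> t \<in> outside ?S \<and> q \<in> inside ?S"
    "q \<in> inside ?S \<and> p \<in> outside ?S \<or> q \<in> outside ?S \<and> p \<in> inside ?S"
    using TP TQ by blast+
  then show False
    using inside_Int_outside [of ?S] by blast
qed

section \<open>Drawn walks\<close>

fun walk_edges :: "'v list \<Rightarrow> 'v set set" where
  "walk_edges (u # v # vs) = insert {u, v} (walk_edges (v # vs))"
| "walk_edges _ = {}"

lemma Union_walk_edges_subset: "\<Union>(walk_edges vs) \<subseteq> set vs"
  by (induction vs rule: walk_edges.induct) auto

lemma Union_walk_edges: "length vs \<ge> 2 \<Longrightarrow> \<Union>(walk_edges vs) = set vs"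
proof (induction vs rule: walk_edges.induct)
  case (1 u v vs)
  then show ?case by (cases vs) auto
qed auto

locale drawn_graph =
  fixes G :: "'v graph" and p :: "'v \<Rightarrow> complex" and \<gamma> :: "'v set \<Rightarrow> real \<Rightarrow> complex"
  assumes drawing: "plane_drawing G p \<gamma>"
    and edges_subset: "e \<in> edges G \<Longrightarrow> e \<subseteq> verts G"
begin

definition trace :: "'v set set \<Rightarrow> complex set" where
  "trace F = (\<Union>e\<in>F. path_image (\<gamma> e))"

lemma p_inj: "u \<in> verts G \<Longrightarrow> v \<in> verts G \<Longrightarrow> p u = p v \<Longrightarrow> u = v"
  using drawing by (auto simp: plane_drawing_def inj_on_def)

lemma edge_arc: "e \<in> edges G \<Longrightarrow> arc (\<gamma> e)"
  and edge_ends: "e \<in> edges G \<Longrightarrow> {pathstart (\<gamma> e), pathfinish (\<gamma> e)} = p ` e"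
  and edge_verts: "e \<in> edges G \<Longrightarrow> path_image (\<gamma> e) \<inter> p ` verts G = p ` e"
  and edges_Int: "e \<in> edges G \<Longrightarrow> f \<in> edges G \<Longrightarrow> e \<noteq> f \<Longrightarrow>
      path_image (\<gamma> e) \<inter> path_image (\<gamma> f) = p ` (e \<inter> f)"
  using drawing by (auto simp: plane_drawing_def)

text \<open>
  Two disjoint sets of edges of a drawing meet only in common vertices, as single edges do. This
  reduces disjointness of drawn paths to disjointness of vertex lists.
\<close>

lemma trace_Int:
  assumes "F \<subseteq> edges G" "F' \<subseteq> edges G" "F \<inter> F' = {}"
  shows "trace F \<inter> trace F' = p ` (\<Union>F \<inter> \<Union>F')"
proof -
  have "path_image (\<gamma> e) \<inter> path_image (\<gamma> f) = p ` (e \<inter> f)" if "e \<in> F" "f \<in> F'" for e f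
    using edges_Int [of e f] assms that by blast
  moreover have "trace F \<inter> trace F' = (\<Union>e\<in>F. \<Union>f\<in>F'. path_image (\<gamma> e) \<inter> path_image (\<gamma> f))"
    by (auto simp: trace_def)
  ultimately have "trace F \<inter> trace F' = (\<Union>e\<in>F. \<Union>f\<in>F'. p ` (e \<inter> f))"
    by simp
  then show ?thesis
    by (auto simp: image_Union)
qed

lemma trace_verts:
  assumes "F \<subseteq> edges G" "W \<subseteq> verts G"
  shows "trace F \<inter> p ` W = p ` (\<Union>F \<inter> W)"
proof -
  have "path_image (\<gamma> e) \<inter> p ` W = p ` (e \<inter> W)" if "e \<in> F" for e
    using edge_verts [of e] edges_subset [of e] assms that p_inj by blast
  then show ?thesis
    unfolding trace_def by blast
qed

lemma directed_edge_arc: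
  assumes "{u, v} \<in> edges G"
  obtains g where "arc g" "pathstart g = p u" "pathfinish g = p v" "path_image g = path_image (\<gamma> {u, v})"
proof -
  have "{pathstart (\<gamma> {u, v}), pathfinish (\<gamma> {u, v})} = {p u, p v}"
    using edge_ends [OF assms] by simp
  then consider "pathstart (\<gamma> {u, v}) = p u" "pathfinish (\<gamma> {u, v}) = p v"
    | "pathstart (\<gamma> {u, v}) = p v" "pathfinish (\<gamma> {u, v}) = p u"
    by (auto simp: doubleton_eq_iff)
  then show ?thesis
    using that [of "\<gamma> {u, v}"] that [of "reversepath (\<gamma> {u, v})"] edge_arc [OF assms]
    by cases (auto simp: arc_reversepath)
qed

lemma walk_arc:
  assumes "distinct vs" "length vs \<ge> 2" "walk_edges vs \<subseteq> edges G"
  shows "\<exists>g. arc g \<and> pathstart g = p (hd vs) \<and> pathfinish g = p (last vs) \<and>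
    path_image g = trace (walk_edges vs)"
  using assms
proof (induction vs rule: walk_edges.induct)
  case (1 u v vs)
  obtain g where g: "arc g" "pathstart g = p u" "pathfinish g = p v"
      "path_image g = trace {{u, v}}"
    using directed_edge_arc [of u v] "1.prems" by (auto simp: trace_def)
  show ?case
  proof (cases "vs = []")
    case True
    then show ?thesis using g by auto
  next
    case False
    then have len: "length (v # vs) \<ge> 2"
      by (cases vs) auto
    then obtain h where h: "arc h" "pathstart h = p v" "pathfinish h = p (last (v # vs))"
        "path_image h = trace (walk_edges (v # vs))"
      using 1 by auto
    have "{u, v} \<notin> walk_edges (v # vs)"
      using Union_walk_edges_subset [of "v # vs"] "1.prems"(1) by auto
    then have "path_image g \<inter> path_image h = p ` ({u, v} \<inter> set (v # vs))"
      using trace_Int [of "{{u, v}}" "walk_edges (v # vs)"] "1.prems" Union_walk_edges [OF len] g(4) h(4)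
      by simp
    then have "path_image g \<inter> path_image h \<subseteq> {p v}"
      using "1.prems"(1) by auto
    then have "arc (g +++ h)"
      using g h by (intro arc_join) auto
    moreover have "path_image (g +++ h) = trace (walk_edges (u # v # vs))"
      using g h by (auto simp: path_image_join trace_def)
    ultimately show ?thesis
      using g h False by (intro exI [of _ "g +++ h"]) auto
  qed
qed auto

lemma half_open_edge_connected:
  assumes "{x, u} \<in> edges G"
  shows "connected (path_image (\<gamma> {x, u}) - {p u})" "p u \<in> closure (path_image (\<gamma> {x, u}) - {p u})"
    "x \<noteq> u" "p x \<in> path_image (\<gamma> {x, u}) - {p u}"
proof -
  obtain g where g: "arc g" "pathstart g = p x" "pathfinish g = p u"
      "path_image g = path_image (\<gamma> {x, u})"
    using directed_edge_arc [OF assms] .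
  have "g ` ({0..1} - {1}) = g ` {0..1} - g ` {1}"
    using g(1) by (intro inj_on_image_set_diff [of g "{0..1}"]) (auto simp: arc_def)
  moreover have "{0..<1} = {0..1} - {1::real}"
    by auto
  ultimately have "path_image g - {p u} = g ` {0..<1}"
    using g(3) by (simp add: path_image_def pathfinish_def)
  moreover have "connected (g ` {0..<1})"
    using g(1) unfolding arc_def path_def
    by (intro connected_continuous_image) (auto intro: continuous_on_subset)
  ultimately show "connected (path_image (\<gamma> {x, u}) - {p u})"
    using g(4) by simp
  show "p u \<in> closure (path_image (\<gamma> {x, u}) - {p u})"
    using endpoints_in_closure_open_arc [OF g(1-3)] closure_mono [of "path_image g - {p x, p u}" "path_image g - {p u}"]
    unfolding g(4) by blast
  show "x \<noteq> u" "p x \<in> path_image (\<gamma> {x, u}) - {p u}"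
    using arc_distinct_ends [OF g(1)] g pathstart_in_path_image [of g] by auto
qed

text \<open>
  A walk together with half-open edges: for \<open>(x, u)\<close> in \<open>L\<close> the edge
  from the vertex \<open>x\<close> of the walk is added without its far end \<open>u\<close>.
  The result is the connected set that touches the points \<open>u\<close> without containing
  them, as the theorems on theta curves require.
\<close>

definition sprout :: "'v list \<Rightarrow> ('v \<times> 'v) set \<Rightarrow> complex set" where
  "sprout xs L = p ` set xs \<union> trace (walk_edges xs) \<union> (\<Union>(x, u)\<in>L. path_image (\<gamma> {x, u}) - {p u})"

lemma sprout:
  assumes xs: "xs \<noteq> []" "walk_edges xs \<subseteq> edges G" "set xs \<subseteq> verts G"
    and L: "\<And>x u. (x, u) \<in> L \<Longrightarrow> x \<in> set xs \<and> {x, u} \<in> edges G"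
  shows "connected (sprout xs L)"
    and "(x, u) \<in> L \<Longrightarrow> p u \<in> closure (sprout xs L)"
    and "F \<subseteq> edges G \<Longrightarrow> \<Union>F \<inter> set xs = {} \<Longrightarrow> sprout xs L \<inter> trace F = {}"
proof -
  have stem: "connected (p ` set xs \<union> trace (walk_edges xs))"
    using xs(1,2)
  proof (induction xs rule: walk_edges.induct)
    case (1 u v vs)
    have "connected (path_image (\<gamma> {u, v}))"
      using "1.prems" by (simp add: connected_arc_image edge_arc)
    moreover have "connected (p ` set (v # vs) \<union> trace (walk_edges (v # vs)))"
      using 1 by simp
    moreover have ends: "{p u, p v} \<subseteq> path_image (\<gamma> {u, v})"
      using edge_verts [of "{u, v}"] "1.prems" by auto
    then have "path_image (\<gamma> {u, v}) \<inter> (p ` set (v # vs) \<union> trace (walk_edges (v # vs))) \<noteq> {}"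
      by auto
    ultimately have "connected (path_image (\<gamma> {u, v}) \<union> (p ` set (v # vs) \<union> trace (walk_edges (v # vs))))"
      by (rule connected_Un)
    also have "path_image (\<gamma> {u, v}) \<union> (p ` set (v # vs) \<union> trace (walk_edges (v # vs))) =
        p ` set (u # v # vs) \<union> trace (walk_edges (u # v # vs))"
      using ends by (auto simp: trace_def)
    finally show ?case .
  qed (auto simp: trace_def)
  let ?S = "p ` set xs \<union> trace (walk_edges xs)"
  have "connected (?S \<union> (path_image (\<gamma> {x, u}) - {p u}))" if "(x, u) \<in> L" for x u
    using half_open_edge_connected [of x u] L [OF that] by (intro connected_Un stem) auto
  then have "connected (\<Union>(insert ?S ((\<lambda>(x, u). ?S \<union> (path_image (\<gamma> {x, u}) - {p u})) ` L)))"
  proof (intro connected_Union)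
    have "p (hd xs) \<in> \<Inter>(insert ?S ((\<lambda>(x, u). ?S \<union> (path_image (\<gamma> {x, u}) - {p u})) ` L))"
      using xs(1) by auto
    then show "\<Inter>(insert ?S ((\<lambda>(x, u). ?S \<union> (path_image (\<gamma> {x, u}) - {p u})) ` L)) \<noteq> {}"
      by blast
  qed (use stem in auto)
  moreover have "\<Union>(insert ?S ((\<lambda>(x, u). ?S \<union> (path_image (\<gamma> {x, u}) - {p u})) ` L)) = sprout xs L"
    by (auto simp: sprout_def)
  ultimately show "connected (sprout xs L)"
    by simp
  show "p u \<in> closure (sprout xs L)" if "(x, u) \<in> L"
  proof -
    have "path_image (\<gamma> {x, u}) - {p u} \<subseteq> sprout xs L"
      using that by (auto simp: sprout_def)
    then show ?thesis
      using half_open_edge_connected(2) [of x u] L [OF that] closure_mono by blast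
  qed
  show "sprout xs L \<inter> trace F = {}" if F: "F \<subseteq> edges G" "\<Union>F \<inter> set xs = {}"
  proof -
    have "trace F \<inter> p ` set xs = {}"
      using trace_verts [OF F(1) xs(3)] F(2) by simp
    moreover have "walk_edges xs \<inter> F = {}"
    proof -
      have "e \<noteq> {}" if "e \<in> F" for e
        using edge_ends [of e] F(1) that by auto
      then show ?thesis
        using Union_walk_edges_subset [of xs] F(2) by blast
    qed
    then have "trace (walk_edges xs) \<inter> trace F = {}"
      using trace_Int [OF xs(2) F(1)] Union_walk_edges_subset [of xs] F(2) by blast
    moreover have "(path_image (\<gamma> {x, u}) - {p u}) \<inter> trace F = {}" if "(x, u) \<in> L" for x u
    proof -
      have "{{x, u}} \<inter> F = {}"
        using L [OF that] F(2) by blast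
      then have "path_image (\<gamma> {x, u}) \<inter> trace F = p ` ({x, u} \<inter> \<Union>F)"
        using trace_Int [of "{{x, u}}" F] L [OF that] F(1) by (simp add: trace_def)
      then show ?thesis
        using L [OF that] F(2) by auto
    qed
    ultimately show ?thesis
      unfolding sprout_def by blast
  qed
qed

definition theta_walks :: "'v \<Rightarrow> 'v \<Rightarrow> 'v list \<Rightarrow> 'v list \<Rightarrow> 'v list \<Rightarrow> bool" where
  "theta_walks a b vs1 vs2 vs3 \<longleftrightarrow> a \<noteq> b \<and>
     (\<forall>vs \<in> {vs1, vs2, vs3}. distinct vs \<and> length vs \<ge> 2 \<and> hd vs = a \<and> last vs = b \<and> walk_edges vs \<subseteq> edges G) \<and>
     set vs1 \<inter> set vs2 = {a, b} \<and> set vs1 \<inter> set vs3 = {a, b} \<and> set vs2 \<inter> set vs3 = {a, b} \<and>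
     walk_edges vs1 \<inter> walk_edges vs2 = {} \<and> walk_edges vs1 \<inter> walk_edges vs3 = {} \<and>
     walk_edges vs2 \<inter> walk_edges vs3 = {}"

lemma theta_walks_curve:
  assumes "theta_walks a b vs1 vs2 vs3"
  obtains g1 g2 g3 where "theta_curve (p a) (p b) g1 g2 g3"
    "path_image g1 = trace (walk_edges vs1)" "path_image g2 = trace (walk_edges vs2)"
    "path_image g3 = trace (walk_edges vs3)"
proof -
  have w: "distinct vs" "length vs \<ge> 2" "hd vs = a" "last vs = b" "walk_edges vs \<subseteq> edges G"
    if "vs \<in> {vs1, vs2, vs3}" for vs
    using assms that unfolding theta_walks_def by blast+
  have "\<exists>g. arc g \<and> pathstart g = p a \<and> pathfinish g = p b \<and> path_image g = trace (walk_edges vs)"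
    if "vs \<in> {vs1, vs2, vs3}" for vs
    using walk_arc [OF w(1,2,5)] w(3,4) that by metis
  then obtain g1 g2 g3 where g:
    "arc g1" "pathstart g1 = p a" "pathfinish g1 = p b" "path_image g1 = trace (walk_edges vs1)"
    "arc g2" "pathstart g2 = p a" "pathfinish g2 = p b" "path_image g2 = trace (walk_edges vs2)"
    "arc g3" "pathstart g3 = p a" "pathfinish g3 = p b" "path_image g3 = trace (walk_edges vs3)"
    by (metis insertCI)
  have int: "trace (walk_edges vs) \<inter> trace (walk_edges vs') = {p a, p b}"
    if "vs \<in> {vs1, vs2, vs3}" "vs' \<in> {vs1, vs2, vs3}" "walk_edges vs \<inter> walk_edges vs' = {}"
      "set vs \<inter> set vs' = {a, b}" for vs vs'
    using trace_Int [OF w(5) w(5) that(3)] that by (simp add: Union_walk_edges w(2))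
  have ab: "p a \<noteq> p b"
    using arc_distinct_ends [OF g(1)] g(2,3) by simp
  have "theta_curve (p a) (p b) g1 g2 g3"
    using assms unfolding theta_curve_def theta_walks_def
    by (auto simp: g ab int)
  with g show ?thesis
    by (intro that) auto
qed

lemma theta_walks_no_triple:
  assumes \<theta>: "theta_walks a b vs1 vs2 vs3"
    and xs: "xs \<noteq> []" "walk_edges xs \<subseteq> edges G" "set xs \<subseteq> verts G"
      "set xs \<inter> (set vs1 \<union> set vs2 \<union> set vs3) = {}"
    and touch: "\<And>vs. vs \<in> {vs1, vs2, vs3} \<Longrightarrow> \<exists>u \<in> set vs - {a, b}. \<exists>x\<in>set xs. {x, u} \<in> edges G"
  shows False
proof -
  define L where "L = {(x, u). x \<in> set xs \<and> {x, u} \<in> edges G}"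
  obtain g1 g2 g3 where g: "theta_curve (p a) (p b) g1 g2 g3"
    "path_image g1 = trace (walk_edges vs1)" "path_image g2 = trace (walk_edges vs2)"
    "path_image g3 = trace (walk_edges vs3)"
    using theta_walks_curve [OF \<theta>] .
  note sp = sprout [OF xs(1-3), of L]
  have w: "length vs \<ge> 2" "walk_edges vs \<subseteq> edges G" "hd vs = a" "last vs = b"
    if "vs \<in> {vs1, vs2, vs3}" for vs
    using \<theta> that unfolding theta_walks_def by blast+
  have off: "sprout xs L \<inter> trace (walk_edges vs) = {}" if "vs \<in> {vs1, vs2, vs3}" for vs
    using xs(4) that by (intro sp(3) w) (auto simp: L_def Union_walk_edges w)
  have "closure (sprout xs L) \<inter> (trace (walk_edges vs) - {p a, p b}) \<noteq> {}"
    if vs: "vs \<in> {vs1, vs2, vs3}" for vs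
  proof -
    obtain u x where u: "u \<in> set vs" "u \<noteq> a" "u \<noteq> b" "x \<in> set xs" "{x, u} \<in> edges G"
      using touch [OF vs] by blast
    have ends: "a \<in> set vs" "b \<in> set vs"
      using w(1,3,4) [OF vs] hd_in_set [of vs] last_in_set [of vs] by (cases vs; force)+
    have sub: "set vs \<subseteq> verts G"
      using w(2) [OF vs] edges_subset Union_walk_edges [OF w(1) [OF vs]] by blast
    have "p u \<in> closure (sprout xs L)"
      using u by (intro sp(2) [of x]) (auto simp: L_def)
    moreover have "p u \<in> trace (walk_edges vs)"
      using trace_verts [OF w(2) [OF vs] sub] u(1) Union_walk_edges [OF w(1) [OF vs]] by auto
    moreover have "p u \<noteq> p a" "p u \<noteq> p b"
      using p_inj u ends sub by blast+
    ultimately show ?thesis by blast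
  qed
  then show False
    using theta_no_triple_touch [OF g(1) sp(1)] off unfolding g(2-4)
    by (auto simp: L_def Int_Un_distrib)
qed

lemma tetrahedron_no_common_neighbour:
  assumes K4: "distinct [a, b, c, d]"
      "{{a, b}, {a, c}, {a, d}, {b, c}, {b, d}, {c, d}} \<subseteq> edges G"
    and xs: "xs \<noteq> []" "walk_edges xs \<subseteq> edges G" "set xs \<subseteq> verts G" "set xs \<inter> {a, b, c, d} = {}"
    and touch: "\<And>u. u \<in> {a, b, c, d} \<Longrightarrow> \<exists>x\<in>set xs. {x, u} \<in> edges G"
  shows False
proof -
  have V: "{a, b, c, d} \<subseteq> verts G"
    using K4(2) edges_subset by blast
  define L where "L = {(x, u). x \<in> set xs \<and> {x, u} \<in> edges G}"
  note sp = sprout [OF xs(1-3), of L]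
  have \<theta>: "theta_walks a b [a, c, b] [a, d, b] [a, b]" "theta_walks c d [c, a, d] [c, b, d] [c, d]"
    using K4 by (auto simp: theta_walks_def doubleton_eq_iff insert_commute)
  obtain g1 g2 g3 where g: "theta_curve (p a) (p b) g1 g2 g3"
    "path_image g1 = trace (walk_edges [a, c, b])" "path_image g2 = trace (walk_edges [a, d, b])"
    "path_image g3 = trace (walk_edges [a, b])"
    using theta_walks_curve [OF \<theta>(1)] .
  obtain h1 h2 h3 where h: "theta_curve (p c) (p d) h1 h2 h3"
    "path_image h1 = trace (walk_edges [c, a, d])" "path_image h2 = trace (walk_edges [c, b, d])"
    "path_image h3 = trace (walk_edges [c, d])"
    using theta_walks_curve [OF \<theta>(2)] .
  have inj: "p u = p v \<longleftrightarrow> u = v" if "u \<in> {a, b, c, d}" "v \<in> {a, b, c, d}" for u v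
    using p_inj V that by blast
  have on: "p u \<in> trace F" if "u \<in> e" "e \<in> F" "F \<subseteq> edges G" for u e F
    using edge_verts [of e] edges_subset [of e] that unfolding trace_def by blast
  show False
  proof (rule no_touch_all_of_tetrahedron [OF g(1) h(1)])
    show "path_image g1 \<union> path_image g2 = path_image h1 \<union> path_image h2"
      unfolding g h by (auto simp: trace_def insert_commute)
    show "p c \<in> path_image g1 - {p a, p b}" "p d \<in> path_image g2 - {p a, p b}"
      "p a \<in> path_image h1 - {p c, p d}" "p b \<in> path_image h2 - {p c, p d}"
      using K4(1) on [of c "{a, c}" "walk_edges [a, c, b]"] on [of d "{a, d}" "walk_edges [a, d, b]"]
        on [of a "{c, a}" "walk_edges [c, a, d]"] on [of b "{c, b}" "walk_edges [c, b, d]"] K4(2)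
      unfolding g h by (auto simp: inj insert_commute)
    show "path_image g3 \<inter> path_image h3 = {}"
      using trace_Int [of "walk_edges [a, b]" "walk_edges [c, d]"] K4 unfolding g h
      by (auto simp: doubleton_eq_iff)
    show "connected (sprout xs L)"
      by (intro sp) (auto simp: L_def)
    show "sprout xs L \<inter> (path_image g1 \<union> path_image g2 \<union> path_image g3 \<union> path_image h3) = {}"
    proof -
      have "sprout xs L \<inter> trace F = {}"
        if "F \<subseteq> {{a, b}, {a, c}, {a, d}, {b, c}, {b, d}, {c, d}}" for F
      proof (rule sp(3))
        show "F \<subseteq> edges G"
          using that K4(2) by (rule subset_trans)
        show "\<Union>F \<inter> set xs = {}"
          using Union_mono [OF that] xs(4) by auto
      qed (auto simp: L_def)
      then show ?thesis
        unfolding g h Int_Un_distrib by (simp add: insert_commute)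
    qed
    show "{p a, p b, p c, p d} \<subseteq> closure (sprout xs L)"
    proof -
      have "p u \<in> closure (sprout xs L)" if "u \<in> {a, b, c, d}" for u
        using touch [OF that] sp(2) [of _ u] by (auto simp: L_def)
      then show ?thesis by simp
    qed
  qed
qed

end

section \<open>Forbidden configurations in line graphs\<close>

lemma line_graph_edge_iff:
  "{e, f} \<in> edges (line_graph G) \<longleftrightarrow> e \<in> edges G \<and> f \<in> edges G \<and> e \<noteq> f \<and> e \<inter> f \<noteq> {}"
  by (auto simp: line_graph_def doubleton_eq_iff)

lemma planar_line_graph_drawn:
  assumes "planar (line_graph G)"
  obtains p \<gamma> where "drawn_graph (line_graph G) p \<gamma>"
  using assms unfolding planar_def drawn_graph_def by (auto simp: line_graph_def)

text \<open>
  The four edges at \<open>v\<close> are pairwise adjacent vertices of the line graph. The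
  remaining edges \<open>es\<close> form a connected set next to each of them, which a drawing
  of the complete graph on four vertices does not admit. An edge of \<open>es\<close> may itself
  contain \<open>v\<close>, as a fifth edge of a star does.
\<close>

lemma nonplanar_line_graph_star_bypass:
  assumes N: "distinct ns" "length ns = 4" "\<And>n. n \<in> set ns \<Longrightarrow> {v, n} \<in> edges G"
    and es: "es \<noteq> []" "set es \<subseteq> edges G" "walk_edges es \<subseteq> edges (line_graph G)"
    and off: "\<And>n. n \<in> set ns \<Longrightarrow> {v, n} \<notin> set es"
    and meet: "\<And>n. n \<in> set ns \<Longrightarrow> \<exists>e \<in> set es. v \<in> e \<or> n \<in> e"
  shows "\<not> planar (line_graph G)"
proof
  assume "planar (line_graph G)"
  then obtain p \<gamma> where "drawn_graph (line_graph G) p \<gamma>"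
    by (rule planar_line_graph_drawn)
  then interpret drawn_graph "line_graph G" p \<gamma> .
  obtain a b c d where ns: "ns = [a, b, c, d]"
    using N(2) by (auto simp: length_Suc_conv numeral_eq_Suc)
  show False
  proof (rule tetrahedron_no_common_neighbour)
    show "distinct [{v, a}, {v, b}, {v, c}, {v, d}]"
      using N(1) unfolding ns by (auto simp: doubleton_eq_iff)
    then show "{{{v, a}, {v, b}}, {{v, a}, {v, c}}, {{v, a}, {v, d}}, {{v, b}, {v, c}},
        {{v, b}, {v, d}}, {{v, c}, {v, d}}} \<subseteq> edges (line_graph G)"
      using N(3) unfolding ns by (simp add: line_graph_edge_iff)
    show "set es \<inter> {{v, a}, {v, b}, {v, c}, {v, d}} = {}"
      using off unfolding ns by auto
    show "\<exists>e\<in>set es. {e, f} \<in> edges (line_graph G)" if f: "f \<in> {{v, a}, {v, b}, {v, c}, {v, d}}" for f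
    proof -
      obtain n where n: "n \<in> set ns" "f = {v, n}"
        using f unfolding ns by auto
      then obtain e where "e \<in> set es" "v \<in> e \<or> n \<in> e"
        using meet by blast
      then have "{e, f} \<in> edges (line_graph G)"
        using n N(3) off es(2) unfolding line_graph_edge_iff by blast
      then show ?thesis
        using \<open>e \<in> set es\<close> by blast
    qed
  qed (use es in \<open>auto simp: line_graph_def\<close>)
qed

text \<open>
  Edges inside \<open>U\<close> or inside \<open>V\<close> are permitted: the complete bipartite
  graph need not be induced.
\<close>

definition contains_biclique :: "'v graph \<Rightarrow> 'v set \<Rightarrow> 'v set \<Rightarrow> bool" where
  "contains_biclique G U V \<longleftrightarrow> U \<inter> V = {} \<and> (\<forall>u\<in>U. \<forall>v\<in>V. {u, v} \<in> edges G)"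

lemma contains_biclique_commute:
  assumes "contains_biclique G U V"
  shows "contains_biclique G V U"
  unfolding contains_biclique_def
proof (intro conjI ballI)
  show "V \<inter> U = {}"
    using assms by (auto simp: contains_biclique_def)
  show "{v, u} \<in> edges G" if "v \<in> V" "u \<in> U" for u v
    using assms that by (subst insert_commute) (simp add: contains_biclique_def)
qed

lemma obtain_distinct_list:
  assumes "n \<le> card U"
  obtains us where "distinct us" "length us = n" "set us \<subseteq> U"
proof -
  obtain W where "W \<subseteq> U" "card W = n" "finite W"
    using obtain_subset_with_card_n [OF assms] .
  moreover obtain us where "set us = W" "distinct us"
    using finite_distinct_list [OF \<open>finite W\<close>] by blast
  ultimately show ?thesis
    using that distinct_card by metis
qed

text \<open>
  A fifth edge at the centre of a star is adjacent to four others.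
\<close>

lemma nonplanar_line_graph_K_1_5:
  assumes "contains_biclique G U V" "card U \<ge> 5" "V \<noteq> {}"
  shows "\<not> planar (line_graph G)"
proof -
  obtain us where us: "distinct us" "length us = 5" "set us \<subseteq> U"
    using obtain_distinct_list [OF assms(2)] .
  then obtain u ns where ns: "us = u # ns" "length ns = 4"
    by (auto simp: length_Suc_conv numeral_eq_Suc)
  obtain v where "v \<in> V"
    using assms(3) by blast
  then have *: "{v, n} \<in> edges G" if "n \<in> U" for n
    using assms(1) that unfolding contains_biclique_def by (metis insert_commute)
  show ?thesis
    by (rule nonplanar_line_graph_star_bypass [of ns v G "[{v, u}]"])
      (use us ns * in \<open>auto simp: doubleton_eq_iff\<close>)
qed

text \<open>
  The edges at the second centre connect the four leaves of the first.
\<close>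

lemma nonplanar_line_graph_K_2_4:
  assumes "contains_biclique G U V" "card U \<ge> 4" "card V \<ge> 2"
  shows "\<not> planar (line_graph G)"
proof -
  obtain us where us: "distinct us" "length us = 4" "set us \<subseteq> U"
    using obtain_distinct_list [OF assms(2)] .
  obtain vs where "distinct vs" "length vs = 2" "set vs \<subseteq> V"
    using obtain_distinct_list [OF assms(3)] .
  then obtain v w where vw: "v \<in> V" "w \<in> V" "v \<noteq> w"
    by (auto simp: length_Suc_conv numeral_eq_Suc)
  have *: "{v, n} \<in> edges G" "{w, n} \<in> edges G" "n \<noteq> v" "n \<noteq> w" if "n \<in> U" for n
    using assms(1) that vw unfolding contains_biclique_def by (auto simp: insert_commute)
  obtain a b c d where abcd: "us = [a, b, c, d]"
    using us(2) by (auto simp: length_Suc_conv numeral_eq_Suc)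
  show ?thesis
  proof (rule nonplanar_line_graph_star_bypass [of us v G "map (\<lambda>n. {w, n}) us"])
    show "walk_edges (map (\<lambda>n. {w, n}) us) \<subseteq> edges (line_graph G)"
      using us * unfolding abcd by (auto simp: line_graph_edge_iff doubleton_eq_iff)
  qed (use us vw * in \<open>auto simp: doubleton_eq_iff\<close>)
qed

text \<open>
  The path through the neighbours of the hub connects them without passing through the hub. This
  configuration is responsible for all rings with nilpotent elements.
\<close>

lemma nonplanar_line_graph_fan:
  assumes "distinct [h, a, b, c, d]"
    "{{h, a}, {h, b}, {h, c}, {h, d}, {a, b}, {b, c}, {c, d}} \<subseteq> edges G"
  shows "\<not> planar (line_graph G)"
proof (rule nonplanar_line_graph_star_bypass [of "[a, b, c, d]" h G "[{a, b}, {b, c}, {c, d}]"])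
  show "walk_edges [{a, b}, {b, c}, {c, d}] \<subseteq> edges (line_graph G)"
    using assms by (simp add: line_graph_edge_iff doubleton_eq_iff)
  show "{h, n} \<notin> set [{a, b}, {b, c}, {c, d}]" if "n \<in> set [a, b, c, d]" for n
    using assms(1) that by (auto simp: doubleton_eq_iff)
qed (use assms in auto)

text \<open>
  The line graph contains the 3 by 3 rook graph, with \<open>e i j\<close> in row
  \<open>i\<close> and column \<open>j\<close>. It has no four pairwise adjacent vertices, so
  the theorem on theta curves is used: three disjoint paths join \<open>e 1 2\<close> and
  \<open>e 2 2\<close>, and the edge between \<open>e 0 0\<close> and \<open>e 0 1\<close> has a
  neighbour inside each of them.
\<close>

lemma nonplanar_line_graph_K_3_3:
  assumes "contains_biclique G U V" "card U \<ge> 3" "card V \<ge> 3"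
  shows "\<not> planar (line_graph G)"
proof
  assume "planar (line_graph G)"
  then obtain p \<gamma> where "drawn_graph (line_graph G) p \<gamma>"
    by (rule planar_line_graph_drawn)
  then interpret drawn_graph "line_graph G" p \<gamma> .
  obtain us where us: "distinct us" "length us = 3" "set us \<subseteq> U"
    using obtain_distinct_list [OF assms(2)] .
  obtain vs where vs: "distinct vs" "length vs = 3" "set vs \<subseteq> V"
    using obtain_distinct_list [OF assms(3)] .
  define e where "e i j = {us ! i, vs ! j}" for i j
  have uv: "us ! i \<in> U" "vs ! i \<in> V" if "i < 3" for i
    using us vs that nth_mem by fastforce+
  then have ne: "us ! i \<noteq> vs ! j" if "i < 3" "j < 3" for i j
    using assms(1) that unfolding contains_biclique_def by fastforce
  have e_eq: "e i j = e k l \<longleftrightarrow> i = k \<and> j = l" if "i < 3" "j < 3" "k < 3" "l < 3" for i j k l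
    using that ne us vs by (auto simp: e_def doubleton_eq_iff nth_eq_iff_index_eq)
  have e_edge: "e i j \<in> edges G" if "i < 3" "j < 3" for i j
    using assms(1) uv that by (auto simp: e_def contains_biclique_def)
  have rook: "{e i j, e k l} \<in> edges (line_graph G)"
    if "i < 3" "j < 3" "k < 3" "l < 3" "(i, j) \<noteq> (k, l)" "i = k \<or> j = l" for i j k l
    using that e_edge e_eq by (auto simp: line_graph_edge_iff) (auto simp: e_def)
  show False
  proof (rule theta_walks_no_triple)
    show "theta_walks (e 1 2) (e 2 2) [e 1 2, e 0 2, e 2 2] [e 1 2, e 1 0, e 2 0, e 2 2]
        [e 1 2, e 1 1, e 2 1, e 2 2]"
      unfolding theta_walks_def by (auto simp: e_eq rook doubleton_eq_iff)
    show "walk_edges [e 0 0, e 0 1] \<subseteq> edges (line_graph G)"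
      by (simp add: rook)
    show "set [e 0 0, e 0 1] \<subseteq> verts (line_graph G)"
      using e_edge by (simp add: line_graph_def)
    show "\<exists>u\<in>set ws - {e 1 2, e 2 2}. \<exists>x\<in>set [e 0 0, e 0 1]. {x, u} \<in> edges (line_graph G)"
      if "ws \<in> {[e 1 2, e 0 2, e 2 2], [e 1 2, e 1 0, e 2 0, e 2 2], [e 1 2, e 1 1, e 2 1, e 2 2]}"
      for ws
      using that rook [of 0 0 0 2] rook [of 0 0 1 0] rook [of 0 1 1 1] by (auto simp: e_eq)
  qed (auto simp: e_eq)
qed

section \<open>A planar host\<close>

text \<open>
  Twice the signed area of the triangle with vertices \<open>a\<close>, \<open>b\<close> and
  \<open>c\<close>.
\<close>

definition orient :: "complex \<Rightarrow> complex \<Rightarrow> complex \<Rightarrow> real" where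
  "orient a b c = (Re b - Re a) * (Im c - Im a) - (Im b - Im a) * (Re c - Re a)"

lemma orient_convex:
  "orient a b ((1 - t) *\<^sub>R c + t *\<^sub>R d) = (1 - t) * orient a b c + t * orient a b d"
  by (simp add: orient_def algebra_simps)

lemma orient_degenerate [simp]: "orient a b a = 0" "orient a b b = 0"
  by (auto simp: orient_def algebra_simps)

lemma orient_segment: "x \<in> closed_segment a b \<Longrightarrow> orient a b x = 0"
  by (auto simp: closed_segment_def orient_convex)

text \<open>
  Both ends of the second segment lie strictly on one side of the line through the first.
\<close>

lemma closed_segments_disjoint:
  assumes "orient a b c * orient a b d > 0"
  shows "closed_segment a b \<inter> closed_segment c d = {}"
proof -
  have "orient a b x \<noteq> 0" if x: "x \<in> closed_segment c d" for x
  proof -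
    obtain t where t: "0 \<le> t" "t \<le> 1" "x = (1 - t) *\<^sub>R c + t *\<^sub>R d"
      using x by (auto simp: closed_segment_def)
    have "0 < (1 - t) * r + t * s" if "r > 0" "s > 0" for r s :: real
      using t(1,2) that by (cases "t = 0") (auto intro: add_nonneg_pos)
    from this [of "orient a b c" "orient a b d"] this [of "- orient a b c" "- orient a b d"]
    show ?thesis
      using assms unfolding t(3) orient_convex by (auto simp: zero_less_mult_iff)
  qed
  then show ?thesis
    using orient_segment by blast
qed

lemma closed_segments_common_end:
  assumes "orient a b d \<noteq> 0"
  shows "closed_segment a b \<inter> closed_segment a d = {a}"
proof -
  have "x = a" if x: "x \<in> closed_segment a b" "x \<in> closed_segment a d" for x
  proof -
    obtain t where "x = (1 - t) *\<^sub>R a + t *\<^sub>R d"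
      using x(2) by (auto simp: closed_segment_def)
    moreover from this have "t = 0"
      using orient_segment [OF x(1)] assms by (simp add: orient_convex)
    ultimately show ?thesis by simp
  qed
  then show ?thesis by auto
qed

text \<open>
  If no three vertices are collinear, then segments with a common end meet nowhere else and
  vertices avoid other edges. Only the pairs of disjoint edges have to be tested, and for these
  it suffices that the line through one of them leaves the other on one side.
\<close>

lemma planar_straight_line:
  fixes P :: "'v \<Rightarrow> complex"
  assumes E: "\<And>e. e \<in> edges G \<Longrightarrow> \<exists>a\<in>verts G. \<exists>b\<in>verts G. a \<noteq> b \<and> e = {a, b}"
    and inj: "inj_on P (verts G)"
    and general: "\<And>a b c. {a, b, c} \<subseteq> verts G \<Longrightarrow> distinct [a, b, c] \<Longrightarrow> orient (P a) (P b) (P c) \<noteq> 0"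
    and separated: "\<And>a b c d. {a, b} \<in> edges G \<Longrightarrow> {c, d} \<in> edges G \<Longrightarrow> distinct [a, b, c, d] \<Longrightarrow>
      orient (P a) (P b) (P c) * orient (P a) (P b) (P d) > 0 \<or>
      orient (P c) (P d) (P a) * orient (P c) (P d) (P b) > 0"
  shows "planar G"
proof -
  obtain s t where st: "\<And>e. e \<in> edges G \<Longrightarrow> s e \<in> verts G \<and> t e \<in> verts G \<and> s e \<noteq> t e \<and> e = {s e, t e}"
    using E by metis
  define \<gamma> where "\<gamma> e = linepath (P (s e)) (P (t e))" for e
  have seg: "path_image (\<gamma> {a, b}) = closed_segment (P a) (P b)" if "{a, b} \<in> edges G" for a b
    using st [OF that] by (auto simp: \<gamma>_def doubleton_eq_iff closed_segment_commute)
  have vert: "P w \<notin> closed_segment (P a) (P b)"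
    if "{a, b, w} \<subseteq> verts G" "distinct [a, b, w]" for a b w
    using general [OF that] orient_segment by blast
  have "path_image (\<gamma> e) \<inter> P ` verts G = P ` e" if e: "e \<in> edges G" for e
  proof -
    obtain a b where ab: "a \<in> verts G" "b \<in> verts G" "a \<noteq> b" "e = {a, b}"
      using E [OF e] by blast
    then show ?thesis
      using vert [of a b] seg [of a b] e by auto
  qed
  moreover have "path_image (\<gamma> e) \<inter> path_image (\<gamma> f) = P ` (e \<inter> f)"
    if ef: "e \<in> edges G" "f \<in> edges G" "e \<noteq> f" for e f
  proof (cases "e \<inter> f = {}")
    case True
    obtain a b where ab: "a \<noteq> b" "e = {a, b}"
      using E [OF ef(1)] by blast
    obtain c d where cd: "c \<noteq> d" "f = {c, d}"
      using E [OF ef(2)] by blast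
    have "distinct [a, b, c, d]"
      using True ab cd by auto
    then have "closed_segment (P a) (P b) \<inter> closed_segment (P c) (P d) = {}"
      using separated [of a b c d] ef ab cd closed_segments_disjoint by blast
    then show ?thesis
      using True ef ab cd seg by auto
  next
    case False
    then obtain a where a: "a \<in> e" "a \<in> f"
      by blast
    then obtain b d where bd: "e = {a, b}" "f = {a, d}" "a \<noteq> b" "a \<noteq> d" "{a, b, d} \<subseteq> verts G"
      using E [OF ef(1)] E [OF ef(2)] by fastforce
    then have "orient (P a) (P b) (P d) \<noteq> 0"
      using general [of a b d] ef(3) by auto
    then have "closed_segment (P a) (P b) \<inter> closed_segment (P a) (P d) = {P a}"
      by (rule closed_segments_common_end)
    then show ?thesis
      using bd seg ef by auto
  qed
  moreover have "arc (\<gamma> e) \<and> {pathstart (\<gamma> e), pathfinish (\<gamma> e)} = P ` e" if "e \<in> edges G" for e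
  proof -
    have "P (s e) \<noteq> P (t e)"
      using st [OF that] inj by (auto dest: inj_onD)
    then have "arc (\<gamma> e)" "{pathstart (\<gamma> e), pathfinish (\<gamma> e)} = P ` {s e, t e}"
      by (auto simp: \<gamma>_def)
    then show ?thesis
      using st [OF that] by simp
  qed
  ultimately have "plane_drawing G P \<gamma>"
    using inj by (auto simp: plane_drawing_def)
  then show ?thesis
    unfolding planar_def by blast
qed

text \<open>
  The vertices 0 to 5 form an octahedron with opposite faces 0, 1, 2 and 3, 4, 5, and the vertex
  6 is stacked on the face 3, 4, 5. All planar line graphs that are needed embed into this one
  graph: the complete graph on four vertices as 3, 4, 5, 6; the prism with the triangles 0, 1, 2
  and 3, 4, 5; and a triangle 3, 4, 5 with the triangles of apex 0, 1 and 2 on its sides.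
\<close>

definition host_edges :: "(nat \<times> nat) list" where
  "host_edges = [(0,1), (1,2), (0,2), (0,3), (1,3), (1,4), (2,4), (0,5), (2,5), (3,4), (4,5), (3,5), (3,6), (4,6), (5,6)]"

definition host :: "nat graph" where
  "host = ({..<7}, {{a, b} | a b. (a, b) \<in> set host_edges})"

text \<open>
  Small integer coordinates of a straight-line drawing with no three points on a line.
\<close>

definition host_point :: "nat \<Rightarrow> int \<times> int" where
  "host_point i = [(5, 5), (5, 8), (4, 6), (6, 1), (0, 4), (4, 5), (1, 4)] ! i"

definition host_orient :: "nat \<Rightarrow> nat \<Rightarrow> nat \<Rightarrow> int" where
  "host_orient i j k = (case (host_point i, host_point j, host_point k) of
     ((a, b), (c, d), (e, f)) \<Rightarrow> (c - a) * (f - b) - (d - b) * (e - a))"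

lemma host_general:
  "\<forall>i\<in>set [0..<7]. \<forall>j\<in>set [0..<7]. \<forall>k\<in>set [0..<7]. distinct [i, j, k] \<longrightarrow> host_orient i j k \<noteq> 0"
  by code_simp

lemma host_separated:
  "\<forall>(a, b)\<in>set host_edges. \<forall>(c, d)\<in>set host_edges. distinct [a, b, c, d] \<longrightarrow>
     host_orient a b c * host_orient a b d > 0 \<or> host_orient c d a * host_orient c d b > 0"
  by code_simp

theorem planar_host: "planar host"
proof -
  define P where "P i = Complex (real_of_int (fst (host_point i))) (real_of_int (snd (host_point i)))" for i
  have orient: "orient (P i) (P j) (P k) = real_of_int (host_orient i j k)" for i j k
    by (simp add: P_def orient_def host_orient_def split: prod.split)
  have orient_swap: "orient (P j) (P i) (P k) = - orient (P i) (P j) (P k)" for i j k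
    by (simp add: orient_def algebra_simps)
  have verts: "verts host = set [0..<7]"
    by (auto simp: host_def)
  have general: "orient (P i) (P j) (P k) \<noteq> 0" if "{i, j, k} \<subseteq> verts host" "distinct [i, j, k]" for i j k
    using host_general that unfolding verts orient by (simp del: set_upt)
  have lt: "\<forall>(a, b)\<in>set host_edges. a < b \<and> b < 7"
    by code_simp
  show ?thesis
  proof (rule planar_straight_line [of host P])
    show "\<exists>a\<in>verts host. \<exists>b\<in>verts host. a \<noteq> b \<and> e = {a, b}" if e: "e \<in> edges host" for e
    proof -
      obtain a b where ab: "(a, b) \<in> set host_edges" "e = {a, b}"
        using e by (auto simp: host_def)
      moreover have "a < b \<and> b < 7"
        using bspec [OF lt ab(1)] by simp
      ultimately show ?thesis
        by (intro bexI [of _ a] bexI [of _ b]) (auto simp: host_def)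
    qed
    show "inj_on P (verts host)"
    proof (rule inj_onI, rule ccontr)
      fix i j assume ij: "i \<in> verts host" "j \<in> verts host" "P i = P j" "i \<noteq> j"
      have "0 \<noteq> i \<and> 0 \<noteq> j \<or> 1 \<noteq> i \<and> 1 \<noteq> j \<or> 2 \<noteq> i \<and> 2 \<noteq> j"
        by arith
      then obtain k where "k \<in> {0, 1, 2}" "k \<noteq> i" "k \<noteq> j"
        by auto
      then have "orient (P i) (P j) (P k) \<noteq> 0"
        using ij by (intro general) (auto simp: host_def)
      then show False
        using ij(3) by (simp add: orient_def)
    qed
    show "orient (P i) (P j) (P k) \<noteq> 0" if "{i, j, k} \<subseteq> verts host" "distinct [i, j, k]" for i j k
      using general [OF that] .
    show "orient (P a) (P b) (P c) * orient (P a) (P b) (P d) > 0 \<or>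
        orient (P c) (P d) (P a) * orient (P c) (P d) (P b) > 0"
      if "{a, b} \<in> edges host" "{c, d} \<in> edges host" "distinct [a, b, c, d]" for a b c d
    proof -
      have sep: "orient (P a) (P b) (P c) * orient (P a) (P b) (P d) > 0 \<or>
          orient (P c) (P d) (P a) * orient (P c) (P d) (P b) > 0"
        if "(a, b) \<in> set host_edges" "(c, d) \<in> set host_edges" "distinct [a, b, c, d]" for a b c d
      proof -
        have "host_orient a b c * host_orient a b d > 0 \<or> host_orient c d a * host_orient c d b > 0"
          using bspec [OF bspec [OF host_separated that(1), unfolded prod.case] that(2)] that(3) by simp
        then show ?thesis
          unfolding orient by (simp flip: of_int_mult)
      qed
      have "(a, b) \<in> set host_edges \<or> (b, a) \<in> set host_edges"
        "(c, d) \<in> set host_edges \<or> (d, c) \<in> set host_edges"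
        using that by (auto simp: host_def doubleton_eq_iff)
      then show ?thesis
        using sep [of a b c d] sep [of b a c d] sep [of a b d c] sep [of b a d c] that(3)
          orient_swap [of b a] orient_swap [of d c]
        by (auto simp: mult.commute)
    qed
  qed
qed

text \<open>
  The vertices of \<open>G\<close> may be listed with repetitions; a choice of indices embeds
  \<open>G\<close> into \<open>H\<close>, and the drawing of \<open>H\<close> restricts to
  \<open>G\<close>.
\<close>

lemma planar_from_enumeration:
  assumes "planar H" "I \<subseteq> verts H" "\<psi> ` I = verts G"
    and E: "\<And>e. e \<in> edges G \<Longrightarrow> \<exists>u\<in>verts G. \<exists>v\<in>verts G. u \<noteq> v \<and> e = {u, v}"
    and adj: "\<And>i j. i \<in> I \<Longrightarrow> j \<in> I \<Longrightarrow> \<psi> i \<noteq> \<psi> j \<Longrightarrow> {\<psi> i, \<psi> j} \<in> edges G \<Longrightarrow> {i, j} \<in> edges H"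
  shows "planar G"
proof -
  obtain p \<gamma> where H: "plane_drawing H p \<gamma>"
    using assms(1) unfolding planar_def by blast
  define \<phi> where "\<phi> = inv_into I \<psi>"
  have \<phi>: "\<phi> v \<in> I" "\<psi> (\<phi> v) = v" if "v \<in> verts G" for v
    using that assms(3) by (auto simp: \<phi>_def inv_into_into f_inv_into_f)
  have inj: "inj_on \<phi> (verts G)"
    using \<phi>(2) by (metis inj_onI)
  have edge: "\<phi> ` e \<in> edges H" "e \<subseteq> verts G" if e: "e \<in> edges G" for e
  proof -
    obtain u v where uv: "u \<in> verts G" "v \<in> verts G" "u \<noteq> v" "e = {u, v}"
      using E [OF e] by blast
    then show "\<phi> ` e \<in> edges H" "e \<subseteq> verts G"
      using adj [of "\<phi> u" "\<phi> v"] \<phi> e by auto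
  qed
  have inj_p: "inj_on p (verts H)" and \<phi>_verts: "\<phi> ` verts G \<subseteq> verts H"
    using H \<phi>(1) assms(2) by (auto simp: plane_drawing_def)
  have H_edge: "arc (\<gamma> f)" "{pathstart (\<gamma> f), pathfinish (\<gamma> f)} = p ` f"
      "path_image (\<gamma> f) \<inter> p ` verts H = p ` f" if "f \<in> edges H" for f
    using H that by (auto simp: plane_drawing_def)
  have "plane_drawing G (p \<circ> \<phi>) (\<lambda>e. \<gamma> (\<phi> ` e))"
    unfolding plane_drawing_def
  proof (intro conjI ballI impI)
    show "inj_on (p \<circ> \<phi>) (verts G)"
      using inj inj_on_subset [OF inj_p \<phi>_verts] by (rule comp_inj_on)
    show "arc (\<gamma> (\<phi> ` e))" "{pathstart (\<gamma> (\<phi> ` e)), pathfinish (\<gamma> (\<phi> ` e))} = (p \<circ> \<phi>) ` e"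
      if "e \<in> edges G" for e
      using H_edge [OF edge(1) [OF that]] by (auto simp: image_comp)
    show "path_image (\<gamma> (\<phi> ` e)) \<inter> (p \<circ> \<phi>) ` verts G = (p \<circ> \<phi>) ` e" if e: "e \<in> edges G" for e
    proof -
      have "(p \<circ> \<phi>) ` e \<subseteq> (p \<circ> \<phi>) ` verts G"
        using edge(2) [OF e] by (rule image_mono)
      moreover have "p ` (\<phi> ` verts G) \<subseteq> p ` verts H"
        using \<phi>_verts by (rule image_mono)
      ultimately show ?thesis
        using H_edge(3) [OF edge(1) [OF e]] by (simp add: image_comp) blast
    qed
    show "path_image (\<gamma> (\<phi> ` e)) \<inter> path_image (\<gamma> (\<phi> ` f)) = (p \<circ> \<phi>) ` (e \<inter> f)"
      if ef: "e \<in> edges G" "f \<in> edges G" "e \<noteq> f" for e f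
    proof -
      have "\<phi> ` e \<noteq> \<phi> ` f" "\<phi> ` e \<inter> \<phi> ` f = \<phi> ` (e \<inter> f)"
        using inj_on_image_eq_iff [OF inj] inj_on_image_Int [OF inj] edge(2) ef by auto
      then show ?thesis
        using H edge(1) ef by (simp add: plane_drawing_def image_comp)
    qed
  qed
  then show ?thesis
    unfolding planar_def by blast
qed

section \<open>Essential annihilators\<close>

definition reduced_ring :: "('a, 'm) ring_scheme \<Rightarrow> bool" where
  "reduced_ring A \<longleftrightarrow> (\<forall>x \<in> carrier A. x \<otimes>\<^bsub>A\<^esub> x = \<zero>\<^bsub>A\<^esub> \<longrightarrow> x = \<zero>\<^bsub>A\<^esub>)"

context cring
begin

lemma ann_ideal: "s \<in> carrier R \<Longrightarrow> ideal (ann R s) R"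
proof (rule idealI)
  assume s: "s \<in> carrier R"
  show "subgroup (ann R s) (add_monoid R)"
    by (rule add.subgroupI) (use s in \<open>auto simp: ann_def r_distr r_minus a_inv_def [symmetric]\<close>)
  show "x \<otimes> a \<in> ann R s" "a \<otimes> x \<in> ann R s" if "a \<in> ann R s" "x \<in> carrier R" for a x
    using that s m_lcomm [of s x a] m_assoc [of s a x] by (auto simp: ann_def)
qed (rule ring_axioms)

text \<open>
  For a non-zero \<open>j\<close> in the ideal \<open>J\<close>, either \<open>s\<close>
  annihilates \<open>j\<close>, or \<open>s \<otimes> j\<close> is a non-zero element of
  \<open>J\<close> annihilated by \<open>s\<close>.
\<close>

lemma essential_ann_square_zero:
  assumes "s \<in> carrier R" "s \<otimes> s = \<zero>"
  shows "essential_ideal (ann R s) R"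
  unfolding essential_ideal_def
proof (intro conjI allI impI)
  show "ideal (ann R s) R"
    by (rule ann_ideal) fact
  fix J assume J: "ideal J R \<and> J \<noteq> {\<zero>}"
  then interpret J: ideal J R
    by simp
  obtain j where j: "j \<in> J" "j \<noteq> \<zero>"
    using J J.zero_closed by blast
  have c: "j \<in> carrier R"
    using j(1) by (rule J.a_Hcarr)
  show "ann R s \<inter> J \<noteq> {\<zero>}"
  proof (cases "s \<otimes> j = \<zero>")
    case True
    then have "j \<in> ann R s \<inter> J"
      using j c by (simp add: ann_def)
    then show ?thesis
      using j(2) by blast
  next
    case False
    have "s \<otimes> (s \<otimes> j) = \<zero>"
      using assms c by (simp flip: m_assoc)
    then have "s \<otimes> j \<in> ann R s \<inter> J"
      using assms(1) c j by (simp add: ann_def J.I_l_closed)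
    then show ?thesis
      using False by blast
  qed
qed

text \<open>
  If the annihilator meets the principal ideal of \<open>s\<close> in
  \<open>r \<otimes> s\<close>, then \<open>r \<otimes> s\<close> has square zero.
\<close>

lemma essential_ann_reduced:
  assumes "reduced_ring R" "s \<in> carrier R" "essential_ideal (ann R s) R"
  shows "s = \<zero>"
proof (rule ccontr)
  assume s: "s \<noteq> \<zero>"
  interpret J: ideal "PIdl s" R
    using assms(2) by (rule cgenideal_ideal)
  have "PIdl s \<noteq> {\<zero>}"
    using cgenideal_self [OF assms(2)] s by blast
  then have "ann R s \<inter> PIdl s \<noteq> {\<zero>}"
    using assms(3) J.is_ideal unfolding essential_ideal_def by blast
  moreover have "\<zero> \<in> ann R s \<inter> PIdl s"
    using assms(2) by (simp add: ann_def)
  ultimately obtain t where t: "t \<in> ann R s" "t \<in> PIdl s" "t \<noteq> \<zero>"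
    by blast
  obtain r where r: "r \<in> carrier R" "t = r \<otimes> s"
    using t(2) unfolding cgenideal_def by blast
  have "t \<otimes> t = r \<otimes> (s \<otimes> t)"
    using r assms(2) by (simp add: m_assoc)
  then have "t \<otimes> t = \<zero>"
    using t(1) r(1) by (simp add: ann_def)
  moreover have "t \<in> carrier R"
    using r assms(2) by simp
  ultimately show False
    using assms(1) t(3) unfolding reduced_ring_def by blast
qed

lemma essential_graph_edge_iff:
  "{u, v} \<in> edges (essential_graph R) \<longleftrightarrow>
     u \<in> nonzero_zero_divisors R \<and> v \<in> nonzero_zero_divisors R \<and> u \<noteq> v \<and>
     essential_ideal (ann R (u \<otimes> v)) R"
proof -
  have "u \<otimes> v = v \<otimes> u" if "u \<in> nonzero_zero_divisors R" "v \<in> nonzero_zero_divisors R"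
    using that by (intro m_comm) (auto simp: nonzero_zero_divisors_def)
  then show ?thesis
    by (auto simp: essential_graph_def doubleton_eq_iff)
qed

lemma essential_graph_edgeI:
  assumes "u \<in> carrier R - {\<zero>}" "v \<in> carrier R - {\<zero>}" "u \<noteq> v" "u \<otimes> v = \<zero>"
  shows "{u, v} \<in> edges (essential_graph R)"
proof -
  have "v \<otimes> u = \<zero>"
    using assms m_comm [of u v] by simp
  then have "u \<in> nonzero_zero_divisors R" "v \<in> nonzero_zero_divisors R"
    using assms unfolding nonzero_zero_divisors_def by blast+
  then show ?thesis
    using assms essential_ann_square_zero [of \<zero>] by (simp add: essential_graph_edge_iff)
qed

text \<open>
  For reduced rings the essential graph is the zero-divisor graph. The condition
  \<open>u \<noteq> v\<close> disappears because a non-zero element of a reduced ring has a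
  non-zero square.
\<close>

lemma reduced_essential_graph_edges:
  assumes "reduced_ring R"
  shows "edges (essential_graph R) =
    {{u, v} | u v. u \<in> carrier R - {\<zero>} \<and> v \<in> carrier R - {\<zero>} \<and> u \<otimes> v = \<zero>}"
proof (intro subset_antisym subsetI)
  fix e assume "e \<in> edges (essential_graph R)"
  then obtain u v where uv: "e = {u, v}" "u \<in> nonzero_zero_divisors R" "v \<in> nonzero_zero_divisors R"
      "essential_ideal (ann R (u \<otimes> v)) R"
    by (auto simp: essential_graph_def)
  then have "u \<in> carrier R - {\<zero>}" "v \<in> carrier R - {\<zero>}"
    by (auto simp: nonzero_zero_divisors_def)
  moreover from this have "u \<otimes> v = \<zero>"
    using essential_ann_reduced [OF assms _ uv(4)] by simp
  ultimately show "e \<in> {{u, v} | u v. u \<in> carrier R - {\<zero>} \<and> v \<in> carrier R - {\<zero>} \<and> u \<otimes> v = \<zero>}"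
    using uv(1) by blast
next
  fix e assume "e \<in> {{u, v} | u v. u \<in> carrier R - {\<zero>} \<and> v \<in> carrier R - {\<zero>} \<and> u \<otimes> v = \<zero>}"
  then obtain u v where uv: "e = {u, v}" "u \<in> carrier R - {\<zero>}" "v \<in> carrier R - {\<zero>}" "u \<otimes> v = \<zero>"
    by blast
  moreover have "u \<noteq> v"
    using uv assms unfolding reduced_ring_def by blast
  ultimately show "e \<in> edges (essential_graph R)"
    by (simp add: essential_graph_edgeI)
qed

section \<open>Idempotents\<close>

lemma one_minus_idempotent:
  assumes e: "e \<in> carrier R" "e \<otimes> e = e"
  shows "\<one> \<ominus> e \<in> carrier R" "(\<one> \<ominus> e) \<otimes> (\<one> \<ominus> e) = \<one> \<ominus> e" "e \<otimes> (\<one> \<ominus> e) = \<zero>"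
    "\<one> \<ominus> (\<one> \<ominus> e) = e" "e \<oplus> (\<one> \<ominus> e) = \<one>"
proof -
  show c: "\<one> \<ominus> e \<in> carrier R"
    using e by simp
  show z: "e \<otimes> (\<one> \<ominus> e) = \<zero>"
    using e by (simp add: minus_eq r_distr r_minus r_neg)
  have "(\<one> \<ominus> e) \<otimes> (\<one> \<ominus> e) = (\<one> \<ominus> e) \<ominus> e \<otimes> (\<one> \<ominus> e)"
    using e by algebra
  then show "(\<one> \<ominus> e) \<otimes> (\<one> \<ominus> e) = \<one> \<ominus> e"
    using z c by (simp add: minus_eq)
  show "\<one> \<ominus> (\<one> \<ominus> e) = e" "e \<oplus> (\<one> \<ominus> e) = \<one>"
    using e by algebra+
qed

lemma nontrivial_idempotent_swap:
  assumes e: "e \<in> carrier R" "e \<noteq> \<zero>" "e \<noteq> \<one>"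
  shows "\<one> \<ominus> e \<noteq> \<zero>" "\<one> \<ominus> e \<noteq> \<one>"
proof -
  have "e = \<one>" if "\<one> \<ominus> e = \<zero>"
    using that e(1) by (simp add: r_right_minus_eq)
  moreover have "e = \<zero>" if "\<one> \<ominus> e = \<one>"
  proof -
    have "e = \<one> \<ominus> (\<one> \<ominus> e)"
      using e(1) by algebra
    then show ?thesis
      unfolding that using r_right_minus_eq by simp
  qed
  ultimately show "\<one> \<ominus> e \<noteq> \<zero>" "\<one> \<ominus> e \<noteq> \<one>"
    using e by blast+
qed

text \<open>
  By finiteness the powers of \<open>x\<close> are eventually periodic, say with period
  \<open>d\<close> from the exponent \<open>i\<close> on; the exponent \<open>i * d\<close> is
  past the start and a multiple of the period, so doubling it changes nothing.
\<close>

lemma idempotent_power: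
  assumes "finite (carrier R)" "x \<in> carrier R"
  obtains k :: nat where "k > 0" "(x [^] k) \<otimes> (x [^] k) = x [^] k"
proof -
  have "\<not> inj_on (\<lambda>n. x [^] n) {1::nat..}"
  proof
    assume "inj_on (\<lambda>n. x [^] n) {1::nat..}"
    moreover have "(\<lambda>n. x [^] n) ` {1::nat..} \<subseteq> carrier R"
      using assms(2) by auto
    ultimately show False
      using assms(1) infinite_Ici inj_on_finite by blast
  qed
  then obtain i j :: nat where "1 \<le> i" "1 \<le> j" "i \<noteq> j" "x [^] i = x [^] j"
    unfolding inj_on_def by auto
  then obtain i d :: nat where id: "i \<ge> 1" "d \<ge> 1" "x [^] i = x [^] (i + d)"
    by (metis add_diff_inverse_nat less_imp_le_nat linorder_neqE_nat not_less zero_less_diff Suc_leI One_nat_def)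
  have shift: "x [^] m = x [^] (m + d)" if "m \<ge> i" for m
  proof -
    have "x [^] i \<otimes> x [^] (m - i) = x [^] (i + d) \<otimes> x [^] (m - i)"
      using id(3) by simp
    then have "x [^] (i + (m - i)) = x [^] (i + d + (m - i))"
      using assms(2) by (simp add: nat_pow_mult)
    then show ?thesis
      using that by (simp add: add.commute add.left_commute)
  qed
  have "x [^] m = x [^] (m + n * d)" if "m \<ge> i" for m n
  proof (induction n)
    case (Suc n)
    then show ?case
      using shift [of "m + n * d"] that by (simp add: add.commute add.left_commute)
  qed simp
  from this [of "i * d" i] have "x [^] (i * d) = x [^] (i * d + i * d)"
    using id(2) by simp
  then have "(x [^] (i * d)) \<otimes> (x [^] (i * d)) = x [^] (i * d)"
    using nat_pow_mult [OF assms(2), of "i * d" "i * d"] by metis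
  then show ?thesis
    using id by (intro that [of "i * d"]) auto
qed

text \<open>
  An element that lies in one maximal ideal and not in another is neither a unit nor nilpotent,
  so its idempotent power is neither one nor zero.
\<close>

lemma nonlocal_obtain_idempotent:
  assumes fin: "finite (carrier R)" and one: "\<one> \<noteq> \<zero>" and nl: "\<not> local_ring R"
  obtains e where "e \<in> carrier R" "e \<otimes> e = e" "e \<noteq> \<zero>" "e \<noteq> \<one>"
proof -
  have "\<exists>M. maximalideal M R"
  proof -
    let ?P = "{I. ideal I R \<and> I \<noteq> carrier R}"
    have sub: "?P \<subseteq> Pow (carrier R)"
      using ideal.axioms(1) additive_subgroup.a_subset by blast
    have "{\<zero>} \<in> ?P"
      using zeroideal one by auto
    moreover have "finite ?P"
      using finite_subset [OF sub] fin by simp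
    ultimately obtain M where M: "M \<in> ?P" "\<forall>I\<in>?P. M \<subseteq> I \<longrightarrow> M = I"
      using finite_has_maximal [of ?P] by blast
    have "maximalideal M R"
      using M by (intro maximalidealI) blast+
    then show ?thesis ..
  qed
  then obtain M N where MN: "maximalideal M R" "maximalideal N R" "M \<noteq> N"
    using nl unfolding local_ring_def by blast
  interpret M: maximalideal M R by fact
  interpret N: maximalideal N R by fact
  interpret NP: primeideal N R
    using maximalideal_prime MN(2) .
  have "\<not> M \<subseteq> N"
    using M.I_maximal [OF N.is_ideal] MN(3) N.a_subset N.I_notcarr by blast
  then obtain x where x: "x \<in> M" "x \<notin> N"
    by blast
  have xc: "x \<in> carrier R"
    using x(1) by (rule M.a_Hcarr)
  obtain k :: nat where k: "k > 0" "(x [^] k) \<otimes> (x [^] k) = x [^] k"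
    using idempotent_power [OF fin xc] .
  have "x [^] n \<notin> N" for n :: nat
  proof (induction n)
    case 0
    show ?case
      using N.one_imp_carrier N.I_notcarr by auto
  next
    case (Suc n)
    then show ?case
      using NP.I_prime [of "x [^] n" x] x(2) xc by auto
  qed
  moreover have "x [^] k \<in> M"
    using k(1) xc x(1) by (cases k) (auto simp: M.I_l_closed)
  ultimately have "x [^] k \<noteq> \<zero>" "x [^] k \<noteq> \<one>"
    using N.zero_closed M.one_imp_carrier M.I_notcarr by metis+
  then show ?thesis
    using that [of "x [^] k"] k(2) xc by simp
qed

end

section \<open>Corner rings\<close>

text \<open>
  The ideal generated by the idempotent \<open>e\<close>, regarded as a ring with identity
  \<open>e\<close>.
\<close>

definition corner :: "('a, 'm) ring_scheme \<Rightarrow> 'a \<Rightarrow> ('a, 'm) ring_scheme" where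
  "corner A e = A\<lparr>carrier := {x \<in> carrier A. e \<otimes>\<^bsub>A\<^esub> x = x}, one := e\<rparr>"

lemma corner_simps [simp]:
  "monoid.mult (corner A e) = monoid.mult A" "ring.add (corner A e) = ring.add A"
  "\<one>\<^bsub>corner A e\<^esub> = e" "\<zero>\<^bsub>corner A e\<^esub> = \<zero>\<^bsub>A\<^esub>"
  by (simp_all add: corner_def)

lemma carrier_corner: "carrier (corner A e) = {x \<in> carrier A. e \<otimes>\<^bsub>A\<^esub> x = x}"
  by (simp add: corner_def)

lemma corner_reduced: "reduced_ring A \<Longrightarrow> reduced_ring (corner A e)"
  by (auto simp: reduced_ring_def carrier_corner)

context cring
begin

lemma corner_cring:
  assumes e: "e \<in> carrier R" "e \<otimes> e = e"
  shows "cring (corner R e)"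
proof (rule cringI)
  show "abelian_group (corner R e)"
  proof (rule abelian_groupI)
    show "\<exists>y\<in>carrier (corner R e). y \<oplus>\<^bsub>corner R e\<^esub> x = \<zero>\<^bsub>corner R e\<^esub>"
      if "x \<in> carrier (corner R e)" for x
      using that e by (intro bexI [of _ "\<ominus> x"]) (auto simp: carrier_corner r_minus l_neg)
  qed (use e in \<open>auto simp: carrier_corner r_distr a_ac\<close>)
  show "Group.comm_monoid (corner R e)"
  proof (rule Group.comm_monoidI)
    show "x \<otimes>\<^bsub>corner R e\<^esub> y \<in> carrier (corner R e)"
      if "x \<in> carrier (corner R e)" "y \<in> carrier (corner R e)" for x y
      using that e by (simp add: carrier_corner flip: m_assoc)
    show "x \<otimes>\<^bsub>corner R e\<^esub> y = y \<otimes>\<^bsub>corner R e\<^esub> x"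
      if "x \<in> carrier (corner R e)" "y \<in> carrier (corner R e)" for x y
      using that by (simp add: carrier_corner m_comm)
  qed (use e in \<open>auto simp: carrier_corner m_assoc\<close>)
qed (auto simp: carrier_corner l_distr)

text \<open>
  The Peirce decomposition: every \<open>x\<close> is the sum of its components
  \<open>e \<otimes> x\<close> and \<open>(\<one> \<ominus> e) \<otimes> x\<close>.
\<close>

lemma ring_iso_corners:
  assumes e: "e \<in> carrier R" "e \<otimes> e = e"
  shows "R \<simeq> RDirProd (corner R e) (corner R (\<one> \<ominus> e))"
proof -
  let ?f = "\<one> \<ominus> e"
  note f = one_minus_idempotent [OF e]
  have fe: "?f \<otimes> e = \<zero>"
    using f(1,3) e(1) m_comm by metis
  have ee: "e \<otimes> (e \<otimes> x) = e \<otimes> x" "?f \<otimes> (?f \<otimes> x) = ?f \<otimes> x" "e \<otimes> (?f \<otimes> x) = \<zero>" "?f \<otimes> (e \<otimes> x) = \<zero>"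
    "e \<otimes> x \<oplus> ?f \<otimes> x = x" if "x \<in> carrier R" for x
    using that e f fe by (simp_all flip: m_assoc l_distr)
  have "(\<lambda>x. (e \<otimes> x, ?f \<otimes> x)) \<in> ring_iso R (RDirProd (corner R e) (corner R ?f))"
  proof (rule ring_iso_memI)
    show "(e \<otimes> x, ?f \<otimes> x) \<in> carrier (RDirProd (corner R e) (corner R ?f))" if "x \<in> carrier R" for x
      using that e f ee by (simp add: RDirProd_carrier carrier_corner)
    have mul: "c \<otimes> (x \<otimes> y) = (c \<otimes> x) \<otimes> (c \<otimes> y)" if "c \<in> carrier R" "c \<otimes> c = c" "x \<in> carrier R" "y \<in> carrier R" for c x y
      by (metis that m_assoc m_comm m_closed)
    show "(e \<otimes> (x \<otimes> y), ?f \<otimes> (x \<otimes> y)) =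
        (e \<otimes> x, ?f \<otimes> x) \<otimes>\<^bsub>RDirProd (corner R e) (corner R ?f)\<^esub> (e \<otimes> y, ?f \<otimes> y)"
      if "x \<in> carrier R" "y \<in> carrier R" for x y
      using that e f mul [of e x y] mul [of ?f x y] by (simp add: RDirProd_def DirProd_def monoid.defs)
    show "(e \<otimes> (x \<oplus> y), ?f \<otimes> (x \<oplus> y)) =
        (e \<otimes> x, ?f \<otimes> x) \<oplus>\<^bsub>RDirProd (corner R e) (corner R ?f)\<^esub> (e \<otimes> y, ?f \<otimes> y)"
      if "x \<in> carrier R" "y \<in> carrier R" for x y
      using that e f by (simp add: RDirProd_def DirProd_def monoid.defs r_distr)
    show "(e \<otimes> \<one>, ?f \<otimes> \<one>) = \<one>\<^bsub>RDirProd (corner R e) (corner R ?f)\<^esub>"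
      using e f by (simp add: RDirProd_def DirProd_def monoid.defs)
    show "bij_betw (\<lambda>x. (e \<otimes> x, ?f \<otimes> x)) (carrier R) (carrier (RDirProd (corner R e) (corner R ?f)))"
    proof (rule bij_betw_byWitness [where f' = "\<lambda>(x, y). x \<oplus> y"])
      show "\<forall>x\<in>carrier R. (case (e \<otimes> x, ?f \<otimes> x) of (x, y) \<Rightarrow> x \<oplus> y) = x"
        using ee(5) by simp
      have "e \<otimes> (x \<oplus> y) = x \<and> ?f \<otimes> (x \<oplus> y) = y"
        if "x \<in> carrier R" "y \<in> carrier R" "e \<otimes> x = x" "?f \<otimes> y = y" for x y
        using that e f ee(3) [of y] ee(4) [of x] by (simp add: r_distr)
      then show "\<forall>z\<in>carrier (RDirProd (corner R e) (corner R ?f)).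
          (e \<otimes> (case z of (x, y) \<Rightarrow> x \<oplus> y), ?f \<otimes> (case z of (x, y) \<Rightarrow> x \<oplus> y)) = z"
        by (auto simp: RDirProd_carrier carrier_corner)
    qed (use e f ee in \<open>auto simp: RDirProd_carrier carrier_corner\<close>)
  qed
  then show ?thesis
    unfolding is_ring_iso_def by blast
qed

lemma card_corners:
  assumes e: "e \<in> carrier R" "e \<otimes> e = e"
  shows "card (carrier R) = card (carrier (corner R e)) * card (carrier (corner R (\<one> \<ominus> e)))"
proof -
  obtain h where "h \<in> ring_iso R (RDirProd (corner R e) (corner R (\<one> \<ominus> e)))"
    using ring_iso_corners [OF e] unfolding is_ring_iso_def by blast
  then have "card (carrier R) = card (carrier (RDirProd (corner R e) (corner R (\<one> \<ominus> e))))"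
    using ring_iso_memE(5) bij_betw_same_card by blast
  then show ?thesis
    by (simp add: RDirProd_carrier card_cartesian_product)
qed

lemma card_corner_ge_2:
  assumes "finite (carrier R)" "e \<in> carrier R" "e \<otimes> e = e" "e \<noteq> \<zero>"
  shows "card (carrier (corner R e)) \<ge> 2"
proof -
  have "{\<zero>, e} \<subseteq> carrier (corner R e)" "finite (carrier (corner R e))"
    using assms by (auto simp: carrier_corner)
  then have "card {\<zero>, e} \<le> card (carrier (corner R e))"
    by (intro card_mono)
  then show ?thesis
    using assms(4) by simp
qed

lemma corner_corner:
  assumes "f \<in> carrier R" "w \<in> carrier R" "f \<otimes> w = w"
  shows "carrier (corner (corner R f) w) = carrier (corner R w)"
proof -
  have "f \<otimes> x = x" if "x \<in> carrier R" "w \<otimes> x = x" for x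
    using that assms by (metis m_assoc)
  then show ?thesis
    using assms by (auto simp: carrier_corner)
qed

section \<open>Small rings\<close>

text \<open>
  The multiples of the identity form an additive subgroup of a group of prime order, so they are
  everything.
\<close>

lemma ring_iso_residue_ring:
  assumes p: "card (carrier R) = p" "Factorial_Ring.prime p"
  shows "R \<simeq> residue_ring (int p)"
proof -
  have fin: "finite (carrier R)"
    using p by (metis card.infinite not_prime_0)
  have p1: "p > 1"
    using p(2) by (rule prime_gt_1_nat)
  have one: "\<one> \<noteq> \<zero>"
    using p1 p(1) carrier_one_zero by (metis One_nat_def card.empty card.insert empty_iff finite.emptyI less_irrefl one_zeroD)
  let ?g = "\<lambda>k::int. [k] \<cdot> \<one>"
  have p0: "?g (int p) = \<zero>"
    using add.pow_order_eq_1 [of \<one>] p(1) by (simp add: order_def add_pow_int_ge)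
  have mod: "?g (k mod int p) = ?g k" for k
  proof -
    have "?g k = ?g (int p * (k div int p) + k mod int p)"
      by simp
    also have "\<dots> = ?g (int p * (k div int p)) \<oplus> ?g (k mod int p)"
      by (simp only: add.int_pow_mult one_closed)
    also have "?g (int p * (k div int p)) = \<zero>"
      using p0 add.int_pow_pow [of \<one> "k div int p" "int p"] by (simp add: mult.commute)
    finally show ?thesis
      by simp
  qed
  have mult: "?g (k * l) = ?g k \<otimes> ?g l" for k l
    using add.int_pow_pow [of \<one> k l] add_pow_ldistr_int [of \<one> "?g l" k]
    by (simp add: mult.commute)
  have inj: "inj_on ?g {0..int p - 1}"
  proof (rule inj_onI, rule ccontr)
    fix k l assume kl: "k \<in> {0..int p - 1}" "l \<in> {0..int p - 1}" "?g k = ?g l" "k \<noteq> l"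
    have "?g (k - l) = \<zero>"
      using kl(3) add.int_pow_diff [of \<one> k l] by (simp add: r_neg)
    have "\<not> int p dvd k - l"
      using kl by (simp flip: mod_eq_dvd_iff)
    then have "coprime (int p) (k - l)"
      using p(2) by (intro prime_imp_coprime) auto
    then obtain x y where "x * int p + y * (k - l) = 1"
      using bezout_int [of "int p" "k - l"] by (auto simp: coprime_iff_gcd_eq_1)
    then have "\<one> = ?g (x * int p + y * (k - l))"
      by simp
    also have "\<dots> = \<zero>"
      using p0 \<open>?g (k - l) = \<zero>\<close> by (simp only: add.int_pow_mult one_closed mult) simp
    finally show False
      using one by simp
  qed
  have "?g \<in> ring_iso (residue_ring (int p)) R"
  proof (rule ring_iso_memI)
    have sub: "?g ` {0..int p - 1} \<subseteq> carrier R"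
      by auto
    then have "?g ` {0..int p - 1} = carrier R"
      using p(1) fin inj by (intro card_subset_eq) (auto simp: card_image)
    then show "bij_betw ?g (carrier (residue_ring (int p))) (carrier R)"
      using inj by (simp add: residue_ring_def bij_betw_def)
  qed (use mod mult in \<open>auto simp: residue_ring_def add.int_pow_mult\<close>)
  moreover have "ring (residue_ring (int p))"
  proof -
    have "residues (int p)"
      using p1 by unfold_locales auto
    then show ?thesis
      using residues.cring cring.axioms(1) by blast
  qed
  ultimately show ?thesis
    using ring_iso_sym unfolding is_ring_iso_def by blast
qed

text \<open>
  Four times the identity is zero and also the square of twice the identity, so the
  characteristic is 2. The elements are then 0, 1, \<open>w\<close> and \<open>1 + w\<close>; in
  a reduced ring the square of \<open>w\<close> is neither 0 nor 1, since otherwise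
  \<open>w\<close> or \<open>1 + w\<close> has square zero. If \<open>w\<close> is not
  idempotent, only \<open>w * w = 1 + w\<close> remains, which is the multiplication of the
  field with four elements.
\<close>

lemma order_4_reduced:
  assumes c: "card (carrier R) = 4" and red: "reduced_ring R"
  shows "R \<simeq> F4 \<or> (\<exists>w\<in>carrier R. w \<otimes> w = w \<and> w \<noteq> \<zero> \<and> w \<noteq> \<one>)"
proof (rule disjCI)
  assume nw: "\<not> (\<exists>w\<in>carrier R. w \<otimes> w = w \<and> w \<noteq> \<zero> \<and> w \<noteq> \<one>)"
  have fin: "finite (carrier R)"
    using c by (metis card.infinite zero_neq_numeral)
  have one: "\<one> \<noteq> \<zero>"
    using c carrier_one_zero one_zeroD by fastforce
  have red: "x = \<zero>" if "x \<in> carrier R" "x \<otimes> x = \<zero>" for x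
    using red that unfolding reduced_ring_def by blast
  have "[(4::nat)] \<cdot> \<one> = \<zero>"
    using add.pow_order_eq_1 [of \<one>] c by (simp add: order_def)
  moreover have "[(4::nat)] \<cdot> \<one> = (\<one> \<oplus> \<one>) \<otimes> (\<one> \<oplus> \<one>)"
    by (simp add: numeral_eq_Suc r_distr l_distr a_assoc)
  ultimately have two: "\<one> \<oplus> \<one> = \<zero>"
    using red [of "\<one> \<oplus> \<one>"] by simp
  have char2: "x \<oplus> x = \<zero>" if "x \<in> carrier R" for x
    using two that l_distr [of \<one> \<one> x] by simp
  have "card {\<zero>, \<one>} < card (carrier R)"
    using one c by simp
  then obtain w where w: "w \<in> carrier R" "w \<noteq> \<zero>" "w \<noteq> \<one>"
    by (metis card_mono finite.emptyI finite.insertI insertCI not_less subsetI)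
  have cancel: "x \<oplus> y = x \<oplus> z \<longleftrightarrow> y = z" if "x \<in> carrier R" "y \<in> carrier R" "z \<in> carrier R" for x y z
    using that by simp
  have "\<one> \<oplus> w \<noteq> \<zero>" "\<one> \<oplus> w \<noteq> \<one>" "\<one> \<oplus> w \<noteq> w"
    using cancel [of \<one> w \<one>] cancel [of \<one> w \<zero>] cancel [of w \<one> \<zero>] w one two a_comm [of \<one> w] by auto
  then have distinct: "card {\<zero>, \<one>, w, \<one> \<oplus> w} = 4"
    using w one by auto
  then have carr: "carrier R = {\<zero>, \<one>, w, \<one> \<oplus> w}"
    using c w(1) fin by (intro card_subset_eq [symmetric]) auto
  have "w \<otimes> w \<noteq> \<one>"
  proof
    assume "w \<otimes> w = \<one>"
    have "(\<one> \<oplus> w) \<otimes> (\<one> \<oplus> w) = (\<one> \<oplus> w) \<oplus> (w \<oplus> w \<otimes> w)"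
      using w(1) by (simp add: l_distr r_distr)
    also have "\<dots> = (\<one> \<oplus> \<one>) \<oplus> (w \<oplus> w)"
      using w(1) \<open>w \<otimes> w = \<one>\<close> by (simp add: a_ac)
    finally have "\<one> \<oplus> w = \<zero>"
      using red [of "\<one> \<oplus> w"] w(1) two char2 by simp
    then show False
      using \<open>\<one> \<oplus> w \<noteq> \<zero>\<close> by simp
  qed
  moreover have "w \<otimes> w \<noteq> \<zero>" "w \<otimes> w \<noteq> w"
    using red w nw by blast+
  ultimately have ww: "w \<otimes> w = \<one> \<oplus> w"
    using carr w(1) by (metis insertE m_closed singletonD)
  define g where "g = (\<lambda>(a::int, b::int). (if a = 0 then \<zero> else \<one>) \<oplus> (if b = 0 then \<zero> else w))"
  have add: "x \<oplus> (x \<oplus> y) = y" if "x \<in> carrier R" "y \<in> carrier R" for x y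
    using that char2 by (simp flip: a_assoc)
  have g: "g (0, 0) = \<zero>" "g (0, 1) = w" "g (1, 0) = \<one>" "g (1, 1) = \<one> \<oplus> w"
    using w(1) by (simp_all add: g_def)
  have "g \<in> ring_iso F4 R"
  proof (rule ring_iso_memI)
    show "bij_betw g (carrier F4) (carrier R)"
      using w one \<open>\<one> \<oplus> w \<noteq> \<zero>\<close> \<open>\<one> \<oplus> w \<noteq> \<one>\<close> \<open>\<one> \<oplus> w \<noteq> w\<close> unfolding carr carrier_F4
      by (simp add: bij_betw_def inj_on_def g) blast
    show "g x \<in> carrier R" if "x \<in> carrier F4" for x
      using that w unfolding carrier_F4 by (auto simp: g)
    show "g (x \<otimes>\<^bsub>F4\<^esub> y) = g x \<otimes> g y" "g (x \<oplus>\<^bsub>F4\<^esub> y) = g x \<oplus> g y"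
      if "x \<in> carrier F4" "y \<in> carrier F4" for x y
      using that w ww char2 two add unfolding carrier_F4
      by (auto simp: g F4_def l_distr r_distr a_ac)
    show "g \<one>\<^bsub>F4\<^esub> = \<one>"
      by (simp add: g F4_def)
  qed
  then show "R \<simeq> F4"
    using ring_iso_sym [of F4 R] cring.axioms(1) [OF fieldE(1) [OF field_F4]]
    unfolding is_ring_iso_def by blast
qed

end

section \<open>Line graphs of essential graphs that are not planar\<close>

context cring
begin

text \<open>
  With \<open>f = \<one> \<ominus> e\<close>, the essential graph contains a fan: all products
  among \<open>n\<close>, \<open>e\<close>, \<open>f\<close>, \<open>e \<oplus> n\<close> and
  \<open>f \<oplus> n\<close> that belong to an edge with \<open>n\<close> or to the path from
  \<open>e\<close> over \<open>f\<close> and \<open>e \<oplus> n\<close> to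
  \<open>f \<oplus> n\<close> are 0 or \<open>n\<close>, and both have square zero.
\<close>

lemma nonplanar_nilpotent_in_corner:
  assumes e: "e \<in> carrier R" "e \<otimes> e = e" "e \<noteq> \<zero>" "e \<noteq> \<one>"
    and n: "n \<in> carrier R" "n \<noteq> \<zero>" "n \<otimes> n = \<zero>" "e \<otimes> n = n"
  shows "\<not> planar (line_graph (essential_graph R))"
proof -
  define f where "f = \<one> \<ominus> e"
  have f: "f \<in> carrier R" "f \<otimes> f = f" "e \<otimes> f = \<zero>" "f \<noteq> \<zero>"
    using one_minus_idempotent [OF e(1,2)] nontrivial_idempotent_swap [OF e(1,3,4)]
    by (auto simp: f_def)
  have fe: "f \<otimes> e = \<zero>"
    using f e(1) m_comm by metis
  have fn: "f \<otimes> n = \<zero>"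
    using fe n(1,4) e(1) f(1) by (metis m_assoc l_null)
  have ne: "n \<otimes> e = n" and nf: "n \<otimes> f = \<zero>"
    using n(1,4) fn e(1) f(1) m_comm by metis+
  note mult = e(2) f(2,3) n(3,4) fe fn ne nf
  note [simp] = mult e(1) f(1) n(1) l_distr r_distr
  have ndiff: "x \<noteq> y" if "c \<otimes> x \<noteq> c \<otimes> y" for c x y
    using that by auto
  \<comment> \<open>each pair is separated by multiplication with one of \<open>e\<close>, \<open>f\<close> and \<open>n\<close>\<close>
  have dist: "distinct [n, e, f, e \<oplus> n, f \<oplus> n]"
    using ndiff [of e n f] ndiff [of n e n] ndiff [of f n "f \<oplus> n"] ndiff [of e e f]
      ndiff [of f e "f \<oplus> n"] ndiff [of f "e \<oplus> n" f] ndiff [of f "e \<oplus> n" "f \<oplus> n"]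
      ndiff [of n "e \<oplus> n" n] ndiff [of e "f \<oplus> n" f] e(3) n(2) f(4) add.l_cancel [of e n \<zero>]
    by auto
  have ne0: "e \<oplus> n \<noteq> \<zero>" "f \<oplus> n \<noteq> \<zero>"
    using ndiff [of n "e \<oplus> n" \<zero>] ndiff [of f "f \<oplus> n" \<zero>] n(2) f(4) by auto
  have nzd: "u \<in> nonzero_zero_divisors R" if "u \<in> carrier R - {\<zero>}" "v \<in> carrier R - {\<zero>}" "u \<otimes> v = \<zero>" for u v
    using that unfolding nonzero_zero_divisors_def by blast
  have V: "{n, e, f, e \<oplus> n, f \<oplus> n} \<subseteq> nonzero_zero_divisors R"
    using nzd [of n n] nzd [of e f] nzd [of f e] nzd [of "e \<oplus> n" f] nzd [of "f \<oplus> n" n] e(3) f(4) n(2) ne0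
    by auto
  have edge: "{u, v} \<in> edges (essential_graph R)"
    if "u \<in> nonzero_zero_divisors R" "v \<in> nonzero_zero_divisors R" "u \<noteq> v" "u \<otimes> v \<in> {\<zero>, n}" for u v
  proof -
    have "essential_ideal (ann R c) R" if "c \<in> {\<zero>, n}" for c
      using that n(1,3) by (intro essential_ann_square_zero) auto
    then show ?thesis
      using that unfolding essential_graph_edge_iff by blast
  qed
  show ?thesis
  proof (rule nonplanar_line_graph_fan [of n e f "e \<oplus> n" "f \<oplus> n"])
    show "{{n, e}, {n, f}, {n, e \<oplus> n}, {n, f \<oplus> n}, {e, f}, {f, e \<oplus> n}, {e \<oplus> n, f \<oplus> n}}
        \<subseteq> edges (essential_graph R)"
      using V dist by (auto intro!: edge)
  qed (rule dist)
qed

text \<open>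
  One of the two components of an element of square zero is non-zero.
\<close>

lemma nonplanar_not_reduced:
  assumes e: "e \<in> carrier R" "e \<otimes> e = e" "e \<noteq> \<zero>" "e \<noteq> \<one>" and "\<not> reduced_ring R"
  shows "\<not> planar (line_graph (essential_graph R))"
proof -
  obtain n where n: "n \<in> carrier R" "n \<otimes> n = \<zero>" "n \<noteq> \<zero>"
    using assms(5) unfolding reduced_ring_def by blast
  let ?f = "\<one> \<ominus> e"
  note f = one_minus_idempotent [OF e(1,2)]
  have corner: "\<not> planar (line_graph (essential_graph R))"
    if c: "c \<in> carrier R" "c \<otimes> c = c" "c \<noteq> \<zero>" "c \<noteq> \<one>" "c \<otimes> n \<noteq> \<zero>" for c
  proof (rule nonplanar_nilpotent_in_corner [OF c(1-4)])
    show "(c \<otimes> n) \<otimes> (c \<otimes> n) = \<zero>"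
      using c n by (simp add: m_ac)
    show "c \<otimes> (c \<otimes> n) = c \<otimes> n"
      using c n by (simp flip: m_assoc)
  qed (use c n in auto)
  have "n = e \<otimes> n \<oplus> ?f \<otimes> n"
    using n e f by (simp flip: l_distr)
  then have "e \<otimes> n \<noteq> \<zero> \<or> ?f \<otimes> n \<noteq> \<zero>"
    using n by auto
  then show ?thesis
    using corner [OF e] corner [OF f(1,2)] nontrivial_idempotent_swap [OF e(1,3,4)] by blast
qed

lemma corner_biclique:
  assumes e: "e \<in> carrier R" "e \<otimes> e = e"
  shows "contains_biclique (essential_graph R)
    (carrier (corner R e) - {\<zero>}) (carrier (corner R (\<one> \<ominus> e)) - {\<zero>})"
proof -
  let ?f = "\<one> \<ominus> e"
  note f = one_minus_idempotent [OF e]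
  have prod: "u \<otimes> v = \<zero>" if "u \<in> carrier (corner R e)" "v \<in> carrier (corner R ?f)" for u v
  proof -
    have uv: "u \<in> carrier R" "v \<in> carrier R" "e \<otimes> u = u" "?f \<otimes> v = v"
      using that by (auto simp: carrier_corner)
    have "e \<otimes> (?f \<otimes> v) = \<zero>"
      using uv(2) e(1) f(1,3) by (simp flip: m_assoc)
    then have "u \<otimes> (e \<otimes> v) = \<zero>"
      using uv by simp
    then show ?thesis
      using uv(1-3) e(1) m_comm [of e u] by (simp flip: m_assoc)
  qed
  have disjoint: "x = \<zero>" if "x \<in> carrier (corner R e)" "x \<in> carrier (corner R ?f)" for x
  proof -
    have x: "x \<in> carrier R" "e \<otimes> x = x" "?f \<otimes> x = x"
      using that by (auto simp: carrier_corner)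
    then have "x = e \<otimes> (?f \<otimes> x)"
      by simp
    also have "\<dots> = (e \<otimes> ?f) \<otimes> x"
      using x(1) e(1) f(1) by (simp flip: m_assoc)
    finally show ?thesis
      using f(3) x(1) by simp
  qed
  show ?thesis
    unfolding contains_biclique_def
  proof (intro conjI ballI)
    show "(carrier (corner R e) - {\<zero>}) \<inter> (carrier (corner R ?f) - {\<zero>}) = {}"
      using disjoint by blast
    show "{u, v} \<in> edges (essential_graph R)"
      if "u \<in> carrier (corner R e) - {\<zero>}" "v \<in> carrier (corner R ?f) - {\<zero>}" for u v
      using that prod [of u v] disjoint by (intro essential_graph_edgeI) (auto simp: carrier_corner)
  qed
qed

text \<open>
  The corners give complete bipartite graphs with one vertex less than elements on each side,
  and those with parts of sizes 1 and 5, 2 and 4, or 3 and 3 are excluded.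
\<close>

lemma planar_corner_sizes:
  assumes fin: "finite (carrier R)"
    and e: "e \<in> carrier R" "e \<otimes> e = e" "e \<noteq> \<zero>" "e \<noteq> \<one>"
    and planar: "planar (line_graph (essential_graph R))"
    and le: "card (carrier (corner R e)) \<le> card (carrier (corner R (\<one> \<ominus> e)))"
  shows "(card (carrier (corner R e)), card (carrier (corner R (\<one> \<ominus> e))))
    \<in> {(2, 2), (2, 3), (2, 4), (2, 5), (3, 3), (3, 4)}"
proof -
  let ?f = "\<one> \<ominus> e"
  let ?m = "card (carrier (corner R e))" and ?n = "card (carrier (corner R ?f))"
  let ?U = "carrier (corner R e) - {\<zero>}" and ?V = "carrier (corner R ?f) - {\<zero>}"
  note f = one_minus_idempotent [OF e(1,2)]
  have UV: "contains_biclique (essential_graph R) ?U ?V"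
    using corner_biclique [OF e(1,2)] .
  then have VU: "contains_biclique (essential_graph R) ?V ?U"
    by (rule contains_biclique_commute)
  have ge: "?m \<ge> 2" "?n \<ge> 2"
    using card_corner_ge_2 [OF fin e(1-3)] card_corner_ge_2 [OF fin f(1,2)]
      nontrivial_idempotent_swap [OF e(1,3,4)] by blast+
  have card: "card ?U = ?m - 1" "card ?V = ?n - 1"
    using e f by (simp_all add: carrier_corner)
  have "?U \<noteq> {}"
    using card(1) ge(1) by (intro notI) simp
  then have "?n \<le> 5"
    using nonplanar_line_graph_K_1_5 [OF VU] planar card by linarith
  moreover have "?n \<le> 4 \<or> ?m \<le> 2"
    using nonplanar_line_graph_K_2_4 [OF VU] planar card by linarith
  moreover have "?n \<le> 3 \<or> ?m \<le> 3"
    using nonplanar_line_graph_K_3_3 [OF UV] planar card by linarith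
  ultimately consider "?m = 2" "?n = 2 \<or> ?n = 3 \<or> ?n = 4 \<or> ?n = 5" | "?m = 3" "?n = 3 \<or> ?n = 4"
    using ge le by linarith
  then show ?thesis
    by cases auto
qed

end

section \<open>Line graphs of essential graphs that are planar\<close>

text \<open>
  A ring isomorphism preserves zero products and hence, for reduced rings, the essential graph.
\<close>

lemma planar_line_graph_essential_iso:
  assumes "cring A" "cring B" "A \<simeq> B" "reduced_ring B" "planar (line_graph (essential_graph B))"
  shows "planar (line_graph (essential_graph A))"
proof -
  interpret A: cring A by fact
  interpret B: cring B by fact
  obtain h where h: "h \<in> ring_iso A B"
    using assms(3) unfolding is_ring_iso_def by blast
  define k where "k = inv_into (carrier A) h"
  have k: "k \<in> ring_iso B A"
    unfolding k_def using ring_iso_set_sym [OF A.ring_axioms h] .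
  have hom: "h \<in> ring_hom A B" "k \<in> ring_hom B A"
    using h k by (auto simp: ring_iso_def)
  have zero: "h \<zero>\<^bsub>A\<^esub> = \<zero>\<^bsub>B\<^esub>" "k \<zero>\<^bsub>B\<^esub> = \<zero>\<^bsub>A\<^esub>"
    using ring_hom_zero [OF hom(1) A.ring_axioms B.ring_axioms]
      ring_hom_zero [OF hom(2) B.ring_axioms A.ring_axioms] by auto
  have bij: "bij_betw k (carrier B) (carrier A)"
    using ring_iso_memE(5) [OF k] .
  then have inj: "inj_on k (carrier B)" and onto: "k ` carrier B = carrier A"
    by (auto simp: bij_betw_def)
  have k0: "k x = \<zero>\<^bsub>A\<^esub> \<longleftrightarrow> x = \<zero>\<^bsub>B\<^esub>" if "x \<in> carrier B" for x
    using inj_on_eq_iff [OF inj that B.zero_closed] zero by simp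
  have km: "k (x \<otimes>\<^bsub>B\<^esub> y) = k x \<otimes>\<^bsub>A\<^esub> k y" if "x \<in> carrier B" "y \<in> carrier B" for x y
    using ring_hom_mult [OF hom(2) that] .
  have prod0: "k x \<otimes>\<^bsub>A\<^esub> k y = \<zero>\<^bsub>A\<^esub> \<longleftrightarrow> x \<otimes>\<^bsub>B\<^esub> y = \<zero>\<^bsub>B\<^esub>" if "x \<in> carrier B" "y \<in> carrier B" for x y
    using k0 [of "x \<otimes>\<^bsub>B\<^esub> y"] km that by simp
  have reduced: "reduced_ring A"
    unfolding reduced_ring_def
  proof (intro ballI impI)
    fix a assume a: "a \<in> carrier A" "a \<otimes>\<^bsub>A\<^esub> a = \<zero>\<^bsub>A\<^esub>"
    obtain x where x: "x \<in> carrier B" "a = k x"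
      using a(1) unfolding onto [symmetric] by blast
    have "x \<otimes>\<^bsub>B\<^esub> x = \<zero>\<^bsub>B\<^esub>"
      using a(2) prod0 [OF x(1) x(1)] x(2) by simp
    then have "x = \<zero>\<^bsub>B\<^esub>"
      using assms(4) x(1) unfolding reduced_ring_def by blast
    then show "a = \<zero>\<^bsub>A\<^esub>"
      using x(2) zero(2) by simp
  qed
  have edges: "edges (essential_graph A) = image k ` edges (essential_graph B)"
  proof (intro subset_antisym subsetI)
    fix e assume "e \<in> edges (essential_graph A)"
    then obtain u v where uv: "e = {u, v}" "u \<in> carrier A - {\<zero>\<^bsub>A\<^esub>}" "v \<in> carrier A - {\<zero>\<^bsub>A\<^esub>}" "u \<otimes>\<^bsub>A\<^esub> v = \<zero>\<^bsub>A\<^esub>"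
      unfolding A.reduced_essential_graph_edges [OF reduced] by blast
    obtain x y where xy: "u = k x" "v = k y" "x \<in> carrier B" "y \<in> carrier B"
      using uv(2,3) unfolding onto [symmetric] by blast
    have "x \<noteq> \<zero>\<^bsub>B\<^esub>" "y \<noteq> \<zero>\<^bsub>B\<^esub>" "x \<otimes>\<^bsub>B\<^esub> y = \<zero>\<^bsub>B\<^esub>"
      using uv(2-4) xy zero(2) prod0 [OF xy(3,4)] by auto
    then have "{x, y} \<in> edges (essential_graph B)"
      using xy(3,4) unfolding B.reduced_essential_graph_edges [OF assms(4)] by blast
    then show "e \<in> image k ` edges (essential_graph B)"
      using uv(1) xy by (intro image_eqI [of _ _ "{x, y}"]) auto
  next
    fix e assume "e \<in> image k ` edges (essential_graph B)"
    then obtain x y where xy: "e = k ` {x, y}" "x \<in> carrier B - {\<zero>\<^bsub>B\<^esub>}" "y \<in> carrier B - {\<zero>\<^bsub>B\<^esub>}" "x \<otimes>\<^bsub>B\<^esub> y = \<zero>\<^bsub>B\<^esub>"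
      unfolding B.reduced_essential_graph_edges [OF assms(4)] by blast
    then have "k x \<in> carrier A - {\<zero>\<^bsub>A\<^esub>}" "k y \<in> carrier A - {\<zero>\<^bsub>A\<^esub>}" "k x \<otimes>\<^bsub>A\<^esub> k y = \<zero>\<^bsub>A\<^esub>"
      using onto k0 prod0 by auto
    then show "e \<in> edges (essential_graph A)"
      unfolding A.reduced_essential_graph_edges [OF reduced] using xy(1) by auto
  qed
  show ?thesis
  proof (rule planar_from_enumeration [OF assms(5), of "edges (essential_graph B)" "image k"])
    show "\<exists>u\<in>verts (line_graph (essential_graph A)). \<exists>v\<in>verts (line_graph (essential_graph A)). u \<noteq> v \<and> e = {u, v}"
      if "e \<in> edges (line_graph (essential_graph A))" for e
      using that by (auto simp: line_graph_def)
    show "{e, f} \<in> edges (line_graph (essential_graph B))"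
      if ef: "e \<in> edges (essential_graph B)" "f \<in> edges (essential_graph B)" "k ` e \<noteq> k ` f"
        "{k ` e, k ` f} \<in> edges (line_graph (essential_graph A))" for e f
    proof -
      have "e \<subseteq> carrier B" "f \<subseteq> carrier B"
        using ef(1,2) unfolding B.reduced_essential_graph_edges [OF assms(4)] by auto
      then have "k ` e \<inter> k ` f = k ` (e \<inter> f)"
        using inj_on_image_Int [OF inj] by blast
      then show ?thesis
        using ef by (auto simp: line_graph_edge_iff)
    qed
  qed (auto simp: line_graph_def edges)
qed

text \<open>
  The edge \<open>es ! i\<close> of \<open>G\<close> is placed at the vertex
  \<open>I ! i\<close> of the host graph.
\<close>

lemma planar_line_graph_listed_edges:
  assumes edges: "set es = edges G"
    and I: "length I = length es" "distinct I" "set I \<subseteq> {..<7}"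
    and adj: "\<And>i j. i < length es \<Longrightarrow> j < length es \<Longrightarrow> es ! i \<noteq> es ! j \<Longrightarrow> es ! i \<inter> es ! j \<noteq> {} \<Longrightarrow>
      (I ! i, I ! j) \<in> set host_edges \<or> (I ! j, I ! i) \<in> set host_edges"
  shows "planar (line_graph G)"
proof -
  define \<psi> where "\<psi> = the \<circ> map_of (zip I es)"
  have \<psi>: "\<psi> (I ! i) = es ! i" if "i < length es" for i
    using that I map_of_zip_nth [of I es i] by (simp add: \<psi>_def)
  have "\<psi> ` set I = set es"
    using \<psi> I(1) by (auto simp: set_conv_nth image_iff)
  show ?thesis
  proof (rule planar_from_enumeration [OF planar_host, of "set I" \<psi>])
    show "\<psi> ` set I = verts (line_graph G)"
      using \<open>\<psi> ` set I = set es\<close> edges by (simp add: line_graph_def)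
    show "\<exists>u\<in>verts (line_graph G). \<exists>v\<in>verts (line_graph G). u \<noteq> v \<and> e = {u, v}"
      if "e \<in> edges (line_graph G)" for e
      using that by (auto simp: line_graph_def)
    show "{a, b} \<in> edges host"
      if ab: "a \<in> set I" "b \<in> set I" "\<psi> a \<noteq> \<psi> b" "{\<psi> a, \<psi> b} \<in> edges (line_graph G)" for a b
    proof -
      obtain i j where ij: "i < length es" "j < length es" "a = I ! i" "b = I ! j"
        using ab(1,2) I(1) by (metis in_set_conv_nth)
      then have "(a, b) \<in> set host_edges \<or> (b, a) \<in> set host_edges"
        using ab(3,4) adj [of i j] \<psi> by (simp add: line_graph_edge_iff)
      then show ?thesis
        unfolding host_def by (auto simp: insert_commute)
    qed
  qed (use I in \<open>auto simp: host_def\<close>)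
qed

lemma planar_line_graph_few_edges:
  assumes "finite (edges G)" "card (edges G) \<le> 4"
  shows "planar (line_graph G)"
proof -
  obtain es where es: "set es = edges G" "distinct es"
    using finite_distinct_list [OF assms(1)] by blast
  then have len: "length es \<le> 4"
    using assms(2) distinct_card by metis
  have K4: "\<forall>i\<in>set [0..<4]. \<forall>j\<in>set [0..<4]. i \<noteq> j \<longrightarrow>
      (3 + i, 3 + j) \<in> set host_edges \<or> (3 + j, 3 + i) \<in> set host_edges"
    by code_simp
  show ?thesis
  proof (rule planar_line_graph_listed_edges [OF es(1), of "[3..<3 + length es]"])
    fix i j assume ij: "i < length es" "j < length es" "es ! i \<noteq> es ! j"
    then have "i \<in> set [0..<4]" "j \<in> set [0..<4]" "i \<noteq> j"
      using len by auto
    then have "(3 + i, 3 + j) \<in> set host_edges \<or> (3 + j, 3 + i) \<in> set host_edges"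
      using K4 by blast
    then show "([3..<3 + length es] ! i, [3..<3 + length es] ! j) \<in> set host_edges \<or>
        ([3..<3 + length es] ! j, [3..<3 + length es] ! i) \<in> set host_edges"
      using ij(1,2) by simp
  qed (use len in auto)
qed

text \<open>
  The line graph is a prism: each of the two vertices in \<open>U\<close> contributes a
  triangle, and each vertex in \<open>V\<close> joins the two triangles by an edge.
\<close>

lemma planar_line_graph_K_2_3:
  assumes "edges G = {{u, v} | u v. u \<in> U \<and> v \<in> V}" "U \<inter> V = {}" "card U = 2" "card V = 3"
  shows "planar (line_graph G)"
proof -
  obtain us where us: "set us = U" "distinct us"
    using finite_distinct_list [of U] assms(3) by (metis card.infinite zero_neq_numeral)
  obtain vs where vs: "set vs = V" "distinct vs"
    using finite_distinct_list [of V] assms(4) by (metis card.infinite zero_neq_numeral)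
  have len: "length us = 2" "length vs = 3"
    using us vs assms(3,4) distinct_card by metis+
  define es where "es = map (\<lambda>i. {us ! (i div 3), vs ! (i mod 3)}) [0..<6]"
  have es: "es ! i = {us ! (i div 3), vs ! (i mod 3)}" "us ! (i div 3) \<in> U" "vs ! (i mod 3) \<in> V"
    if "i < 6" for i
    using that us vs len nth_mem [of "i div 3" us] nth_mem [of "i mod 3" vs] by (auto simp: es_def)
  have prism: "\<forall>i\<in>set [0..<6]. \<forall>j\<in>set [0..<6]. i \<noteq> j \<longrightarrow> i div 3 = j div 3 \<or> i mod 3 = j mod 3 \<longrightarrow>
      (i, j) \<in> set host_edges \<or> (j, i) \<in> set host_edges"
    by code_simp
  show ?thesis
  proof (rule planar_line_graph_listed_edges [of es G "[0..<6]"])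
    show "set es = edges G"
    proof (intro subset_antisym subsetI)
      fix e assume "e \<in> set es"
      then obtain i where i: "i < 6" "e = es ! i"
        by (auto simp: in_set_conv_nth es_def)
      then show "e \<in> edges G"
        using es [OF i(1)] unfolding assms(1) by blast
    next
      fix e assume "e \<in> edges G"
      then obtain u v where uv: "u \<in> U" "v \<in> V" "e = {u, v}"
        unfolding assms(1) by blast
      obtain a where a: "a < 2" "u = us ! a"
        using uv(1) us(1) len(1) by (metis in_set_conv_nth)
      obtain b where b: "b < 3" "v = vs ! b"
        using uv(2) vs(1) len(2) by (metis in_set_conv_nth)
      have "3 * a + b < 6" "(3 * a + b) div 3 = a" "(3 * a + b) mod 3 = b"
        using a(1) b(1) by auto
      then have "e = es ! (3 * a + b)" "3 * a + b < length es"
        using uv(3) a b es(1) [of "3 * a + b"] by (simp_all add: es_def)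
      then show "e \<in> set es"
        using nth_mem by blast
    qed
    fix i j assume ij: "i < length es" "j < length es" "es ! i \<noteq> es ! j" "es ! i \<inter> es ! j \<noteq> {}"
    then have i6: "i < 6" "j < 6" and ne: "i \<noteq> j"
      by (auto simp: es_def)
    have "us ! (i div 3) = us ! (j div 3) \<or> vs ! (i mod 3) = vs ! (j mod 3)"
      using ij(4) es [OF i6(1)] es [OF i6(2)] assms(2) by auto
    moreover have "i div 3 < 2" "j div 3 < 2"
      using i6 by auto
    ultimately have "i div 3 = j div 3 \<or> i mod 3 = j mod 3"
      using nth_eq_iff_index_eq [OF us(2)] nth_eq_iff_index_eq [OF vs(2)] len by simp
    moreover have "i \<in> set [0..<6]" "j \<in> set [0..<6]"
      using i6 by auto
    ultimately have "(i, j) \<in> set host_edges \<or> (j, i) \<in> set host_edges"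
      using prism ne by blast
    then show "([0..<6] ! i, [0..<6] ! j) \<in> set host_edges \<or> ([0..<6] ! j, [0..<6] ! i) \<in> set host_edges"
      using i6 by simp
  qed (auto simp: es_def)
qed

lemma RDirProd_simps:
  "carrier (RDirProd A B) = carrier A \<times> carrier B"
  "(a, b) \<otimes>\<^bsub>RDirProd A B\<^esub> (c, d) = (a \<otimes>\<^bsub>A\<^esub> c, b \<otimes>\<^bsub>B\<^esub> d)"
  "\<zero>\<^bsub>RDirProd A B\<^esub> = (\<zero>\<^bsub>A\<^esub>, \<zero>\<^bsub>B\<^esub>)"
  by (auto simp: RDirProd_def DirProd_def monoid.defs)

lemma RDirProd_cring:
  assumes "cring A" "cring B"
  shows "cring (RDirProd A B)"
proof -
  interpret A: cring A by fact
  interpret B: cring B by fact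
  interpret P: ring "RDirProd A B"
    using RDirProd_ring A.ring_axioms B.ring_axioms .
  show ?thesis
    by unfold_locales (auto simp: RDirProd_simps A.m_comm B.m_comm)
qed

lemma RDirProd_reduced: "reduced_ring A \<Longrightarrow> reduced_ring B \<Longrightarrow> reduced_ring (RDirProd A B)"
  by (auto simp: reduced_ring_def RDirProd_simps)

lemma domain_reduced: "domain A \<Longrightarrow> reduced_ring A"
  by (auto simp: reduced_ring_def domain.integral_iff)

text \<open>
  Zero products of non-zero elements pair the two axes of the product, so the essential graph is
  complete bipartite. Its line graph is small enough to be planar, or it is a prism.
\<close>

lemma planar_product_of_domains:
  assumes A: "cring A" "A \<simeq> RDirProd F K"
    and FK: "domain F" "domain K" "finite (carrier F)" "finite (carrier K)"
    and size: "(card (carrier F) - 1) * (card (carrier K) - 1) \<le> 4 \<or> card (carrier F) = 3 \<and> card (carrier K) = 4"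
  shows "planar (line_graph (essential_graph A))"
proof -
  interpret F: domain F by fact
  interpret K: domain K by fact
  let ?P = "RDirProd F K"
  have red: "reduced_ring ?P"
    using FK by (intro RDirProd_reduced domain_reduced)
  have cr: "cring ?P"
    using RDirProd_cring F.is_cring K.is_cring .
  define U where "U = (\<lambda>x. (x, \<zero>\<^bsub>K\<^esub>)) ` (carrier F - {\<zero>\<^bsub>F\<^esub>})"
  define V where "V = (\<lambda>y. (\<zero>\<^bsub>F\<^esub>, y)) ` (carrier K - {\<zero>\<^bsub>K\<^esub>})"
  have card: "card U = card (carrier F) - 1" "card V = card (carrier K) - 1"
    using FK(3,4) by (simp_all add: U_def V_def card_image inj_on_def)
  have fin: "finite U" "finite V"
    using FK(3,4) by (auto simp: U_def V_def)
  have edges: "edges (essential_graph ?P) = {{u, v} | u v. u \<in> U \<and> v \<in> V}"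
  proof -
    have support: "u \<in> U \<and> v \<in> V \<or> v \<in> U \<and> u \<in> V"
      if "u \<in> carrier ?P - {\<zero>\<^bsub>?P\<^esub>}" "v \<in> carrier ?P - {\<zero>\<^bsub>?P\<^esub>}" "u \<otimes>\<^bsub>?P\<^esub> v = \<zero>\<^bsub>?P\<^esub>" for u v
      using that by (cases u; cases v) (auto simp: RDirProd_simps U_def V_def F.integral_iff K.integral_iff)
    have listed: "u \<in> carrier ?P - {\<zero>\<^bsub>?P\<^esub>}" "v \<in> carrier ?P - {\<zero>\<^bsub>?P\<^esub>}" "u \<otimes>\<^bsub>?P\<^esub> v = \<zero>\<^bsub>?P\<^esub>"
      if "u \<in> U" "v \<in> V" for u v
      using that by (auto simp: RDirProd_simps U_def V_def)
    show ?thesis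
      unfolding cring.reduced_essential_graph_edges [OF cr red]
    proof (intro subset_antisym subsetI)
      fix e assume "e \<in> {{u, v} | u v. u \<in> carrier ?P - {\<zero>\<^bsub>?P\<^esub>} \<and> v \<in> carrier ?P - {\<zero>\<^bsub>?P\<^esub>} \<and> u \<otimes>\<^bsub>?P\<^esub> v = \<zero>\<^bsub>?P\<^esub>}"
      then obtain u v where "e = {u, v}" "u \<in> U \<and> v \<in> V \<or> v \<in> U \<and> u \<in> V"
        using support by blast
      moreover have "{u, v} = {v, u}"
        by (rule insert_commute)
      ultimately show "e \<in> {{u, v} | u v. u \<in> U \<and> v \<in> V}"
        by blast
    next
      fix e assume "e \<in> {{u, v} | u v. u \<in> U \<and> v \<in> V}"
      then show "e \<in> {{u, v} | u v. u \<in> carrier ?P - {\<zero>\<^bsub>?P\<^esub>} \<and> v \<in> carrier ?P - {\<zero>\<^bsub>?P\<^esub>} \<and> u \<otimes>\<^bsub>?P\<^esub> v = \<zero>\<^bsub>?P\<^esub>}"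
        using listed by blast
    qed
  qed
  have "planar (line_graph (essential_graph ?P))"
    using size
  proof
    assume small: "(card (carrier F) - 1) * (card (carrier K) - 1) \<le> 4"
    have E: "edges (essential_graph ?P) = (\<lambda>(u, v). {u, v}) ` (U \<times> V)"
      unfolding edges by auto
    show ?thesis
    proof (rule planar_line_graph_few_edges)
      show "finite (edges (essential_graph ?P))"
        unfolding E using fin by simp
      have "card (edges (essential_graph ?P)) \<le> card (U \<times> V)"
        unfolding E using fin by (intro card_image_le) simp
      then show "card (edges (essential_graph ?P)) \<le> 4"
        using small card by (simp add: card_cartesian_product)
    qed
  next
    assume "card (carrier F) = 3 \<and> card (carrier K) = 4"
    then show ?thesis
      by (intro planar_line_graph_K_2_3 [OF edges]) (auto simp: U_def V_def card [unfolded U_def V_def])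
  qed
  then show ?thesis
    by (rule planar_line_graph_essential_iso [OF A(1) cr A(2) red])
qed

lemma domain_residue_ring: "Factorial_Ring.prime p \<Longrightarrow> domain (residue_ring (int p))"
  by (intro field.axioms(1) residues_prime.is_field residues_prime.intro)

text \<open>
  The essential graph is a triangle with a pendant edge at each vertex. In the line graph the
  edges of the triangle form a triangle again, and each pendant edge is adjacent to two of them;
  the first three entries of \<open>ps\<close> are the pendant edges.
\<close>

lemma planar_Z2_cubed:
  assumes A: "cring A" "A \<simeq> RDirProd (residue_ring 2) (RDirProd (residue_ring 2) (residue_ring 2))"
  shows "planar (line_graph (essential_graph A))"
proof -
  let ?Z = "residue_ring 2"
  let ?P = "RDirProd ?Z (RDirProd ?Z ?Z)"
  have dom: "domain ?Z"
    using domain_residue_ring [of 2] by simp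
  then have cr: "cring ?P"
    by (intro RDirProd_cring) (auto simp: domain_def)
  have red: "reduced_ring ?P"
    using dom by (intro RDirProd_reduced domain_reduced)
  define ps :: "((int \<times> int \<times> int) \<times> (int \<times> int \<times> int)) list"
    where "ps = [((1, 0, 0), (0, 1, 1)), ((0, 1, 0), (1, 0, 1)), ((0, 0, 1), (1, 1, 0)),
      ((1, 0, 0), (0, 1, 0)), ((0, 1, 0), (0, 0, 1)), ((1, 0, 0), (0, 0, 1))]"
  have Z: "carrier ?Z = {0, 1}" "\<zero>\<^bsub>?Z\<^esub> = 0" "x \<otimes>\<^bsub>?Z\<^esub> y = x * y mod 2" for x y
    by (auto simp: residue_ring_def)
  have edges: "edges (essential_graph ?P) = set (map (\<lambda>(u, v). {u, v}) ps)"
  proof -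
    have zero: "(u, v) \<in> set ps \<or> (v, u) \<in> set ps"
      if "u \<in> carrier ?P - {\<zero>\<^bsub>?P\<^esub>}" "v \<in> carrier ?P - {\<zero>\<^bsub>?P\<^esub>}" "u \<otimes>\<^bsub>?P\<^esub> v = \<zero>\<^bsub>?P\<^esub>" for u v
    proof -
      have num: "\<forall>u1\<in>{0, 1}. \<forall>u2\<in>{0, 1}. \<forall>u3\<in>{0, 1}. \<forall>v1\<in>{0, 1}. \<forall>v2\<in>{0, 1}. \<forall>v3\<in>{0, 1}.
          (u1, u2, u3) \<noteq> (0, 0, 0) \<longrightarrow> (v1, v2, v3) \<noteq> (0, 0, 0) \<longrightarrow>
          u1 * v1 mod 2 = 0 \<longrightarrow> u2 * v2 mod 2 = 0 \<longrightarrow> u3 * v3 mod 2 = 0 \<longrightarrow>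
          ((u1, u2, u3), (v1, v2, v3)) \<in> set ps \<or> ((v1, v2, v3), (u1, u2, u3)) \<in> set ps"
        unfolding ps_def by simp
      obtain u1 u2 u3 v1 v2 v3 where uv: "u = (u1, u2, u3)" "v = (v1, v2, v3)"
        by (metis prod.exhaust)
      have "u1 \<in> {0, 1}" "u2 \<in> {0, 1}" "u3 \<in> {0, 1}" "v1 \<in> {0, 1}" "v2 \<in> {0, 1}" "v3 \<in> {0, 1}"
        "(u1, u2, u3) \<noteq> (0, 0, 0)" "(v1, v2, v3) \<noteq> (0, 0, 0)"
        "u1 * v1 mod 2 = 0" "u2 * v2 mod 2 = 0" "u3 * v3 mod 2 = 0"
        using that unfolding uv RDirProd_simps Z by blast+
      then show ?thesis
        unfolding uv by (rule num [rule_format])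
    qed
    have listed: "u \<in> carrier ?P - {\<zero>\<^bsub>?P\<^esub>}" "v \<in> carrier ?P - {\<zero>\<^bsub>?P\<^esub>}" "u \<otimes>\<^bsub>?P\<^esub> v = \<zero>\<^bsub>?P\<^esub>"
      if "(u, v) \<in> set ps" for u v
      using that by (auto simp: RDirProd_simps Z ps_def)
    show ?thesis
      unfolding cring.reduced_essential_graph_edges [OF cr red]
    proof (intro subset_antisym subsetI)
      fix e assume "e \<in> {{u, v} | u v. u \<in> carrier ?P - {\<zero>\<^bsub>?P\<^esub>} \<and> v \<in> carrier ?P - {\<zero>\<^bsub>?P\<^esub>} \<and> u \<otimes>\<^bsub>?P\<^esub> v = \<zero>\<^bsub>?P\<^esub>}"
      then obtain u v where "e = {u, v}" "(u, v) \<in> set ps \<or> (v, u) \<in> set ps"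
        using zero by blast
      moreover have "{u, v} = {v, u}"
        by (rule insert_commute)
      ultimately obtain x y where xy: "(x, y) \<in> set ps" "e = {x, y}"
        by blast
      then show "e \<in> set (map (\<lambda>(u, v). {u, v}) ps)"
        using image_eqI [of e "\<lambda>(u, v). {u, v}" "(x, y)" "set ps"] by simp
    next
      fix e assume "e \<in> set (map (\<lambda>(u, v). {u, v}) ps)"
      then obtain z where "z \<in> set ps" "e = (case z of (u, v) \<Rightarrow> {u, v})"
        unfolding set_map by (rule imageE)
      moreover obtain u v where "z = (u, v)"
        by (rule prod.exhaust)
      ultimately have "(u, v) \<in> set ps" "e = {u, v}"
        by simp_all
      then show "e \<in> {{u, v} | u v. u \<in> carrier ?P - {\<zero>\<^bsub>?P\<^esub>} \<and> v \<in> carrier ?P - {\<zero>\<^bsub>?P\<^esub>} \<and> u \<otimes>\<^bsub>?P\<^esub> v = \<zero>\<^bsub>?P\<^esub>}"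
        using listed by blast
    qed
  qed
  have len: "length ps = 6"
    by (simp add: ps_def)
  have adj: "\<forall>i\<in>set [0..<6]. \<forall>j\<in>set [0..<6]. i \<noteq> j \<longrightarrow>
      {fst (ps ! i), snd (ps ! i)} \<inter> {fst (ps ! j), snd (ps ! j)} \<noteq> {} \<longrightarrow>
      (i, j) \<in> set host_edges \<or> (j, i) \<in> set host_edges"
    unfolding ps_def by code_simp
  have "planar (line_graph (essential_graph ?P))"
  proof (rule planar_line_graph_listed_edges [OF edges [symmetric], of "[0..<6]"])
    let ?es = "map (\<lambda>(u, v). {u, v}) ps"
    fix i j assume ij: "i < length ?es" "j < length ?es" "?es ! i \<noteq> ?es ! j" "?es ! i \<inter> ?es ! j \<noteq> {}"
    then have "i \<in> set [0..<6]" "j \<in> set [0..<6]" "i \<noteq> j"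
      "{fst (ps ! i), snd (ps ! i)} \<inter> {fst (ps ! j), snd (ps ! j)} \<noteq> {}"
      by (auto simp: len case_prod_beta)
    then have "(i, j) \<in> set host_edges \<or> (j, i) \<in> set host_edges"
      using adj by blast
    then show "([0..<6] ! i, [0..<6] ! j) \<in> set host_edges \<or> ([0..<6] ! j, [0..<6] ! i) \<in> set host_edges"
      using ij(1,2) by (simp add: len)
  qed (auto simp: len)
  then show ?thesis
    by (rule planar_line_graph_essential_iso [OF A(1) cr A(2) red])
qed

section \<open>The rings with planar line graph\<close>

lemma RDirProd_iso_cong:
  assumes "A \<simeq> A'" "B \<simeq> B'"
  shows "RDirProd A B \<simeq> RDirProd A' B'"
proof -
  obtain f g where "f \<in> ring_iso A A'" "g \<in> ring_iso B B'"
    using assms unfolding is_ring_iso_def by blast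
  then have "(\<lambda>(r, s). (f r, g s)) \<in> ring_iso (RDirProd A B) (RDirProd A' B')"
    by (rule RDirProd_iso6)
  then show ?thesis
    unfolding is_ring_iso_def by blast
qed

context cring
begin

text \<open>
  The orders of the two corners are known, and corners of prime order are determined by them. A
  corner of order 4 is a field or it splits. In the latter case the ring has three factors, and
  regrouping them as one factor of order 2 and the rest gives a star that is too large if the
  other corner has order 3.
\<close>

lemma planar_imp_listed:
  assumes fin: "finite (carrier R)"
    and e: "e \<in> carrier R" "e \<otimes> e = e" "e \<noteq> \<zero>" "e \<noteq> \<one>"
    and planar: "planar (line_graph (essential_graph R))"
    and le: "card (carrier (corner R e)) \<le> card (carrier (corner R (\<one> \<ominus> e)))"
  shows "R \<simeq> RDirProd (residue_ring 2) (residue_ring 2) \<or>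
     R \<simeq> RDirProd (residue_ring 2) (residue_ring 3) \<or>
     R \<simeq> RDirProd (residue_ring 3) (residue_ring 3) \<or>
     R \<simeq> RDirProd (residue_ring 2) F4 \<or>
     R \<simeq> RDirProd (residue_ring 3) F4 \<or>
     R \<simeq> RDirProd (residue_ring 2) (residue_ring 5) \<or>
     R \<simeq> RDirProd (residue_ring 2) (RDirProd (residue_ring 2) (residue_ring 2))"
proof -
  let ?f = "\<one> \<ominus> e"
  let ?A = "corner R e" and ?B = "corner R ?f"
  note f = one_minus_idempotent [OF e(1,2)]
  interpret A: cring ?A
    using corner_cring [OF e(1,2)] .
  interpret B: cring ?B
    using corner_cring [OF f(1,2)] .
  have red: "reduced_ring R"
    using nonplanar_not_reduced [OF e] planar by blast
  have iso: "R \<simeq> RDirProd C D" if "?A \<simeq> C" "?B \<simeq> D" for C :: "int ring" and D :: "'c ring"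
    using ring_iso_trans [OF ring_iso_corners [OF e(1,2)] RDirProd_iso_cong [OF that]] .
  have sizes: "(card (carrier ?A), card (carrier ?B)) \<in> {(2, 2), (2, 3), (2, 4), (2, 5), (3, 3), (3, 4)}"
    using planar_corner_sizes [OF fin e planar le] .
  have A: "?A \<simeq> residue_ring (int p)" if "card (carrier ?A) = p" "Factorial_Ring.prime p" for p
    using A.ring_iso_residue_ring that .
  have B: "?B \<simeq> residue_ring (int p)" if "card (carrier ?B) = p" "Factorial_Ring.prime p" for p
    using B.ring_iso_residue_ring that .
  have A23: "card (carrier ?A) = 2 \<Longrightarrow> ?A \<simeq> residue_ring 2" "card (carrier ?A) = 3 \<Longrightarrow> ?A \<simeq> residue_ring 3"
    using A [of 2] A [of 3] by auto
  have B235: "card (carrier ?B) = 2 \<Longrightarrow> ?B \<simeq> residue_ring 2" "card (carrier ?B) = 3 \<Longrightarrow> ?B \<simeq> residue_ring 3"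
    "card (carrier ?B) = 5 \<Longrightarrow> ?B \<simeq> residue_ring 5"
    using B [of 2] B [of 3] B [of 5] by auto
  have B4: "?B \<simeq> F4 \<or> card (carrier ?A) = 2 \<and> ?B \<simeq> RDirProd (residue_ring 2) (residue_ring 2)"
    if c4: "card (carrier ?B) = 4"
  proof (unfold disj_imp, rule impI)
    assume "\<not> ?B \<simeq> F4"
    then obtain w where w: "w \<in> carrier ?B" "w \<otimes> w = w" "w \<noteq> \<zero>" "w \<noteq> ?f"
      using B.order_4_reduced [OF c4 corner_reduced [OF red]] by auto
    let ?C = "corner ?B w" and ?D = "corner ?B (\<one>\<^bsub>?B\<^esub> \<ominus>\<^bsub>?B\<^esub> w)"
    have w': "w \<otimes>\<^bsub>?B\<^esub> w = w" "w \<noteq> \<zero>\<^bsub>?B\<^esub>" "w \<noteq> \<one>\<^bsub>?B\<^esub>"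
      using w by auto
    note v = B.one_minus_idempotent [OF w(1) w'(1)]
    have finB: "finite (carrier ?B)"
      using fin by (simp add: carrier_corner)
    have ge: "card (carrier ?C) \<ge> 2" "card (carrier ?D) \<ge> 2"
      using B.card_corner_ge_2 [OF finB w(1) w'(1,2)] B.card_corner_ge_2 [OF finB v(1,2)]
        B.nontrivial_idempotent_swap [OF w(1) w'(2,3)] by blast+
    have "card (carrier ?C) * card (carrier ?D) = 4"
      using B.card_corners [OF w(1) w'(1)] c4 by simp
    then have two: "card (carrier ?C) = 2" "card (carrier ?D) = 2"
      using ge mult_le_mono [of 2 "card (carrier ?C)" 3 "card (carrier ?D)"]
        mult_le_mono [of 3 "card (carrier ?C)" 2 "card (carrier ?D)"] by linarith+
    interpret C: cring ?C
      using B.corner_cring [OF w(1) w'(1)] .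
    interpret D: cring ?D
      using B.corner_cring [OF v(1,2)] .
    have "?C \<simeq> residue_ring 2" "?D \<simeq> residue_ring 2"
      using C.ring_iso_residue_ring [of 2] D.ring_iso_residue_ring [of 2] two by auto
    then have "?B \<simeq> RDirProd (residue_ring 2) (residue_ring 2)"
      using ring_iso_trans [OF B.ring_iso_corners [OF w(1) w'(1)] RDirProd_iso_cong] by blast
    \<comment> \<open>regroup: the corner of \<open>w\<close> has order 2, its complement twice the order of the corner of \<open>e\<close>\<close>
    moreover have "card (carrier ?A) = 2"
    proof -
      have wR: "w \<in> carrier R" "?f \<otimes> w = w"
        using w(1) by (auto simp: carrier_corner)
      have w1: "w \<noteq> \<one>"
        using wR(2) f(1) w(4) by auto
      have card_w: "card (carrier (corner R w)) = 2"
        using corner_corner [OF f(1) wR] two(1) by simp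
      moreover have "card (carrier R) = card (carrier ?A) * 4"
        using card_corners [OF e(1,2)] c4 by simp
      ultimately have "card (carrier (corner R (\<one> \<ominus> w))) = 2 * card (carrier ?A)"
        using card_corners [OF wR(1) w(2)] by simp
      moreover have "card (carrier ?A) \<ge> 2"
        using card_corner_ge_2 [OF fin e(1-3)] .
      ultimately have "(2 :: nat, 2 * card (carrier ?A)) \<in> {(2, 2), (2, 3), (2, 4), (2, 5), (3, 3), (3, 4)}"
        using planar_corner_sizes [OF fin wR(1) w(2,3) w1 planar] unfolding card_w by simp
      then show ?thesis
        using card_corner_ge_2 [OF fin e(1-3)] by auto
    qed
    ultimately show "card (carrier ?A) = 2 \<and> ?B \<simeq> RDirProd (residue_ring 2) (residue_ring 2)"
      by blast
  qed
  consider "card (carrier ?A) = 2" "card (carrier ?B) = 2" | "card (carrier ?A) = 2" "card (carrier ?B) = 3"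
    | "card (carrier ?A) = 2" "card (carrier ?B) = 4" | "card (carrier ?A) = 2" "card (carrier ?B) = 5"
    | "card (carrier ?A) = 3" "card (carrier ?B) = 3" | "card (carrier ?A) = 3" "card (carrier ?B) = 4"
    using sizes by auto
  then show ?thesis
  proof cases
    case 1
    show ?thesis using iso [OF A23(1) [OF 1(1)] B235(1) [OF 1(2)]] by blast
  next
    case 2
    show ?thesis using iso [OF A23(1) [OF 2(1)] B235(2) [OF 2(2)]] by blast
  next
    case 3
    show ?thesis using iso [OF A23(1) [OF 3(1)]] B4 [OF 3(2)] by blast
  next
    case 4
    show ?thesis using iso [OF A23(1) [OF 4(1)] B235(3) [OF 4(2)]] by blast
  next
    case 5
    show ?thesis using iso [OF A23(2) [OF 5(1)] B235(2) [OF 5(2)]] by blast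
  next
    case 6
    then have "?B \<simeq> F4"
      using B4 by simp
    then show ?thesis using iso [OF A23(2) [OF 6(1)]] by blast
  qed
qed

end

theorem theorem3p4:
  fixes A :: "('a, 'm) ring_scheme"
  assumes "cring A"
    and "\<one>\<^bsub>A\<^esub> \<noteq> \<zero>\<^bsub>A\<^esub>"
    and "finite (carrier A)"
    and "\<not> local_ring A"
  shows "planar (line_graph (essential_graph A)) \<longleftrightarrow>
     A \<simeq> RDirProd (residue_ring 2) (residue_ring 2) \<or>
     A \<simeq> RDirProd (residue_ring 2) (residue_ring 3) \<or>
     A \<simeq> RDirProd (residue_ring 3) (residue_ring 3) \<or>
     A \<simeq> RDirProd (residue_ring 2) F4 \<or>
     A \<simeq> RDirProd (residue_ring 3) F4 \<or>
     A \<simeq> RDirProd (residue_ring 2) (residue_ring 5) \<or>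
     A \<simeq> RDirProd (residue_ring 2) (RDirProd (residue_ring 2) (residue_ring 2))"
proof -
  interpret cring A by fact
  obtain e where e: "e \<in> carrier A" "e \<otimes>\<^bsub>A\<^esub> e = e" "e \<noteq> \<zero>\<^bsub>A\<^esub>" "e \<noteq> \<one>\<^bsub>A\<^esub>"
    using nonlocal_obtain_idempotent assms(2-4) by blast
  note f = one_minus_idempotent [OF e(1,2)] nontrivial_idempotent_swap [OF e(1,3,4)]
  have dom: "domain (residue_ring 2)" "domain (residue_ring 3)" "domain (residue_ring 5)" "domain F4"
    using domain_residue_ring [of 2] domain_residue_ring [of 3] domain_residue_ring [of 5]
      field.axioms(1) [OF field_F4] by auto
  have card: "card (carrier (residue_ring n)) = nat n" "finite (carrier (residue_ring n))" for n
    by (auto simp: residue_ring_def)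
  have card4: "card (carrier F4) = 4" "finite (carrier F4)"
    using order_F4 by (auto simp: order_def carrier_F4)
  note product = planar_product_of_domains [OF assms(1)]
  show ?thesis (is "?planar \<longleftrightarrow> ?listed")
  proof
    assume planar: ?planar
    show ?listed
    proof (cases "card (carrier (corner A e)) \<le> card (carrier (corner A (\<one>\<^bsub>A\<^esub> \<ominus>\<^bsub>A\<^esub> e)))")
      case True
      then show ?thesis
        by (rule planar_imp_listed [OF assms(3) e planar])
    next
      case False
      then show ?thesis
        by (intro planar_imp_listed [OF assms(3) f(1,2) f(6,7) planar]) (simp add: f(4))
    qed
  next
    assume ?listed
    moreover have ?planar if "A \<simeq> RDirProd (residue_ring 2) (residue_ring 2)"
      using product [OF that] dom card by simp
    moreover have ?planar if "A \<simeq> RDirProd (residue_ring 2) (residue_ring 3)"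
      using product [OF that] dom card by simp
    moreover have ?planar if "A \<simeq> RDirProd (residue_ring 3) (residue_ring 3)"
      using product [OF that] dom card by simp
    moreover have ?planar if "A \<simeq> RDirProd (residue_ring 2) F4"
      using product [OF that] dom card card4 by simp
    moreover have ?planar if "A \<simeq> RDirProd (residue_ring 3) F4"
      using product [OF that] dom card card4 by simp
    moreover have ?planar if "A \<simeq> RDirProd (residue_ring 2) (residue_ring 5)"
      using product [OF that] dom card by simp
    ultimately show ?planar
      using planar_Z2_cubed [OF assms(1)] by blast
  qed
qed

end
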